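(* Let $N\ge 1$, let $Q$ be a real symmetric positive definite $N\times N$ matrix and let $A$ be a real $N\times N$ matrix with $s(A)\le 0$. Let $L$ be the Ornstein–Uhlenbeck operator associated with $(Q,A)$. Let $u\in C^2(\mathbb{R}^N)$ be a non-negative function with $Lu(x)=0$ for all $x\in\mathbb{R}^N$, and suppose that there exists $c_0>0$ such that $$|u(x)|\le c_0\, e^{c_0|x|},\qquad x\in\mathbb{R}^N.$$ Then $u$ is constant.
   Context: $|\cdot|$ is the Euclidean norm and $\langle\cdot,\cdot\rangle$ the Euclidean inner product on $\mathbb{R}^N$. The Ornstein–Uhlenbeck operator associated with $(Q,A)$ acts on $C^2$ functions $u:\mathbb{R}^N\to\mathbb{R}$ by $$Lu(x)=\tfrac12\,\mathrm{tr}(Q D^2u(x))+\langle Ax, Du(x)\rangle,\qquad x\in\mathbb{R}^N,$$ where $D^2u$ is the Hessian matrix and $Du$ the gradient of $u$. The spectral bound of $A$ is $s(A)=\max\{\mathrm{Re}(\lambda):\lambda\in\sigma(A)\}$, where $\sigma(A)$ is the set of (complex) eigenvalues of $A$. *)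

theory Defs
  imports "HOL-Analysis.Analysis"
begin

definition pos_def_matrix :: "real^'n^'n \<Rightarrow> bool" where
  "pos_def_matrix Q \<longleftrightarrow> transpose Q = Q \<and> (\<forall>x. x \<noteq> 0 \<longrightarrow> x \<bullet> (Q *v x) > 0)"

text \<open>The spectrum of a real matrix consists of the eigenvalues of its complexification,
  i.e. the eigenvectors are complex.\<close>

definition complex_spectrum :: "real^'n^'n \<Rightarrow> complex set" where
  "complex_spectrum A =
    {z. \<exists>v :: complex^'n. v \<noteq> 0 \<and> map_matrix complex_of_real A *v v = z *s v}"

definition spectral_bound :: "real^'n^'n \<Rightarrow> real" where
  "spectral_bound A = Max (Re ` complex_spectrum A)"

definition gradient :: "(real^'n \<Rightarrow> real) \<Rightarrow> real^'n \<Rightarrow> real^'n" where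
  "gradient u x = (THE D. GDERIV u x :> D)"

definition hessian :: "(real^'n \<Rightarrow> real) \<Rightarrow> real^'n \<Rightarrow> real^'n^'n" where
  "hessian u x = jacobian (gradient u) (at x)"

text \<open>Continuity of u and of its gradient is implied by differentiability.\<close>

definition C2 :: "(real^'n \<Rightarrow> real) \<Rightarrow> bool" where
  "C2 u \<longleftrightarrow> u differentiable_on UNIV \<and> gradient u differentiable_on UNIV \<and>
    continuous_on UNIV (hessian u)"

definition ornstein_uhlenbeck ::
  "real^'n^'n \<Rightarrow> real^'n^'n \<Rightarrow> (real^'n \<Rightarrow> real) \<Rightarrow> real^'n \<Rightarrow> real" where
  "ornstein_uhlenbeck Q A u x = 1/2 * trace (Q ** hessian u x) + (A *v x) \<bullet> gradient u x"

lemma gradient_eqI: "GDERIV u x :> D \<Longrightarrow> gradient u x = D"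
  unfolding gradient_def
proof (rule the_equality)
  fix E assume "GDERIV u x :> D" "GDERIV u x :> E"
  then have "(\<lambda>h. h \<bullet> D) = (\<lambda>h. h \<bullet> E)"
    unfolding gderiv_def by (rule has_derivative_unique)
  then show "E = D"
    by (metis vector_eq_ldot)
qed

lemma GDERIV_gradient:
  assumes "u differentiable (at x)"
  shows "GDERIV u x :> gradient u x"
proof -
  obtain f' where f': "(u has_derivative f') (at x)"
    using assms by (auto simp: differentiable_def)
  then have "linear f'"
    by (rule has_derivative_linear)
  then have "f' = (\<lambda>h. h \<bullet> adjoint f' 1)"
    by (simp add: adjoint_works fun_eq_iff)
  then have "GDERIV u x :> adjoint f' 1"
    using f' unfolding gderiv_def by metis
  then show ?thesis
    using gradient_eqI by metis
qed

end

theory Submission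
  imports Defs "HOL-Computational_Algebra.Fundamental_Theorem_Algebra"
begin

text \<open>The proof rests on one inequality: every non-negative solution \<open>u\<close> of exponential growth is
midpoint log-convex, \<open>u(x)\<^sup>2 \<le> u(x + h) u(x - h)\<close>. Once this is known, two
evaluations at the origin finish the argument. Adding a constant, one may take \<open>u\<close>
positive. At the origin the drift vanishes, so \<open>Lu(0) = 0\<close> says that the second
derivatives of \<open>u\<close> weighted by \<open>Q\<close> cancel; but log-convexity bounds each
of them below by the square of a first derivative divided by \<open>u(0)\<close>, so the gradient
vanishes at the origin and, by convexity of \<open>ln u\<close>, the origin is a global minimum
(\<open>origin_is_minimum\<close>). Then \<open>w = u - u(0)\<close> is again a non-negative
solution, and log-convexity gives \<open>w(h)\<^sup>2 \<le> w(2h) w(0) = 0\<close>.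

The inequality is a Harnack inequality for two copies of the diffusion driven by the same noise.
Let \<open>\<eta>\<close> be a path from \<open>h\<close> to \<open>0\<close> and let \<open>c\<close> decrease at least as fast as a multiple of
\<open>|\<eta>' - A\<eta>|\<^sup>2\<close>. Then \<open>sqrt (u(x + \<eta>(t)) u(x - \<eta>(t))) exp (c(t))\<close> is a supersolution of the backward
parabolic equation, while \<open>u\<close> is a solution and the two agree at the final time when \<open>c\<close> ends at \<open>0\<close>.
The maximum principle, for which the growth bound is needed, compares them at time \<open>0\<close>
(\<open>log_concavity_defect_transport\<close>): log-convexity holds up to the factor \<open>exp (2 c(0))\<close>, governed by
the energy spent on steering \<open>h\<close> to the origin.

The spectral condition makes this energy arbitrarily small (\<open>cheaply_steerable_real\<close>). Slowing an
eigenmode \<open>exp (t \<lambda>)\<close> with \<open>Re \<lambda> \<le> 0\<close> to \<open>exp (t (\<lambda> - \<delta>))\<close> costs an energy of order \<open>\<delta>\<close>. A vector that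
is not an eigenvector is split with the resolvent as
\<open>x = (A - \<lambda>)y + \<delta>y\<close>, where \<open>(A - \<lambda> + \<delta>)y = x\<close>: the second summand is steered at a cost of order \<open>\<delta>\<close>,
and the first one has one linear factor more, so that induction along the linear factors of an
annihilating polynomial of \<open>A\<close> applies.\<close>

section \<open>One-dimensional calculus\<close>

lemma second_derivative_nonneg_at_min:
  fixes f f' :: "real \<Rightarrow> real"
  assumes f: "\<And>s. (f has_real_derivative f' s) (at s)"
    and f': "(f' has_real_derivative D) (at 0)"
    and min: "\<And>s. f 0 \<le> f s"
  shows "0 \<le> D"
proof (rule ccontr)
  assume "\<not> 0 \<le> D"
  then obtain d where d: "d > 0" "\<And>h. 0 < h \<Longrightarrow> h < d \<Longrightarrow> f' (0 + h) < f' 0"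
    using DERIV_neg_dec_right[OF f'] by auto
  have "f' 0 = 0"
    by (rule DERIV_local_min[OF f, of 1]) (use min in auto)
  obtain z where z: "0 < z" "z < d/2" "f (d/2) - f 0 = (d/2 - 0) * f' z"
    using MVT2[of 0 "d/2" f f'] f d(1) by auto
  have "f' z < 0"
    using d(2)[of z] z d(1) \<open>f' 0 = 0\<close> by simp
  then have "(d/2 - 0) * f' z < 0"
    using d(1) by (intro mult_pos_neg) auto
  then have "f (d/2) - f 0 < 0"
    unfolding z(3) .
  then show False
    using min[of "d/2"] by simp
qed

lemma right_derivative_nonneg_at_min:
  fixes f :: "real \<Rightarrow> real"
  assumes f: "(f has_real_derivative D) (at 0)" and "b > 0"
    and min: "\<And>s. 0 \<le> s \<Longrightarrow> s \<le> b \<Longrightarrow> f 0 \<le> f s"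
  shows "0 \<le> D"
proof (rule ccontr)
  assume "\<not> 0 \<le> D"
  then obtain d where d: "d > 0" "\<And>h. 0 < h \<Longrightarrow> h < d \<Longrightarrow> f (0 + h) < f 0"
    using DERIV_neg_dec_right[OF f] by auto
  define s where "s = min b (d/2)"
  have "0 < s" "s \<le> b" "s < d"
    using d(1) \<open>b > 0\<close> by (auto simp: s_def min_def)
  then show False
    using d(2)[of s] assms(3)[of s] by simp
qed

text \<open>The geometric mean is kept in the form \<open>exp ((ln f + ln k)/2)\<close>, in which its logarithmic derivative
is the average of those of \<open>f\<close> and \<open>k\<close>.\<close>
lemma geometric_mean_derivative:
  fixes f k c :: "real \<Rightarrow> real"
  assumes "(f has_real_derivative f') (at s)" "(k has_real_derivative k') (at s)"
    and "(c has_real_derivative c') (at s)" and "f s > 0" "k s > 0"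
  shows "((\<lambda>s. exp ((ln (f s) + ln (k s)) / 2 + c s)) has_real_derivative
    exp ((ln (f s) + ln (k s)) / 2 + c s) * ((f' / f s + k' / k s) / 2 + c')) (at s)"
  using assms by (auto intro!: derivative_eq_intros simp: field_simps)

lemma geometric_mean_second_derivative:
  fixes f k f1 k1 :: "real \<Rightarrow> real"
  assumes "(f has_real_derivative f1 s) (at s)" "(k has_real_derivative k1 s) (at s)"
    and "(f1 has_real_derivative f2) (at s)" "(k1 has_real_derivative k2) (at s)"
    and "f s > 0" "k s > 0"
  shows "((\<lambda>s. exp ((ln (f s) + ln (k s)) / 2 + C) * ((f1 s / f s + k1 s / k s) / 2))
    has_real_derivative exp ((ln (f s) + ln (k s)) / 2 + C) *
      (((f1 s / f s + k1 s / k s) / 2)\<^sup>2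
        + (f2 / f s - (f1 s / f s)\<^sup>2 + k2 / k s - (k1 s / k s)\<^sup>2) / 2)) (at s)"
proof -
  have 1: "((\<lambda>s. exp ((ln (f s) + ln (k s)) / 2 + C)) has_real_derivative
    exp ((ln (f s) + ln (k s)) / 2 + C) * ((f1 s / f s + k1 s / k s) / 2)) (at s)"
    using geometric_mean_derivative[OF assms(1,2) DERIV_const[of C] assms(5,6)] by simp
  have 2: "((\<lambda>s. (f1 s / f s + k1 s / k s) / 2) has_real_derivative
      (f2 / f s - (f1 s / f s)\<^sup>2 + k2 / k s - (k1 s / k s)\<^sup>2) / 2) (at s)"
    using assms by (auto intro!: derivative_eq_intros simp: field_simps power2_eq_square)
  have 3: "(e * S) * S + r * e = e * (S\<^sup>2 + r)" for e S r :: real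
    by (simp add: algebra_simps power2_eq_square)
  show ?thesis
    by (rule DERIV_cong[OF DERIV_mult[OF 1 2]]) (rule 3)
qed

text \<open>Makes the Gaussian barrier of the maximum principle beat the growth of the solution.\<close>
lemma gaussian_dominates_exponential:
  fixes c \<epsilon> \<theta> :: real
  assumes "c > 0" "\<epsilon> > 0" "\<theta> > 0"
  obtains R where "\<And>r. r \<ge> R \<Longrightarrow> c * exp (c * r) < \<epsilon> * exp (\<theta> * (1 + r\<^sup>2))"
proof
  define R where "R = max 1 ((\<bar>ln (c / \<epsilon>)\<bar> + c) / \<theta>)"
  fix r assume r: "r \<ge> R"
  then have r1: "r \<ge> 1" and r2: "\<bar>ln (c / \<epsilon>)\<bar> + c \<le> r * \<theta>"
    using assms by (auto simp: R_def divide_le_eq)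
  have "ln (c / \<epsilon>) + c * r \<le> (\<bar>ln (c / \<epsilon>)\<bar> + c) * r"
  proof -
    have "\<bar>ln (c / \<epsilon>)\<bar> * 1 \<le> \<bar>ln (c / \<epsilon>)\<bar> * r"
      using r1 by (intro mult_left_mono) auto
    then show ?thesis by (simp add: algebra_simps)
  qed
  also have "\<dots> \<le> (r * \<theta>) * r"
    using r1 r2 by (intro mult_right_mono) auto
  also have "\<dots> < \<theta> * (1 + r\<^sup>2)"
    using assms by (simp add: algebra_simps power2_eq_square)
  finally have "exp (ln (c / \<epsilon>) + c * r) < exp (\<theta> * (1 + r\<^sup>2))"
    by simp
  then show "c * exp (c * r) < \<epsilon> * exp (\<theta> * (1 + r\<^sup>2))"
    using assms by (simp add: exp_add field_simps)
qed

section \<open>Positive semidefinite matrices as sums of squares\<close>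

text \<open>Subtracting \<open>(F e)(F e)\<^sup>T / (e \<bullet> F e)\<close> keeps the form semidefinite, by the Cauchy-Schwarz
inequality for the form itself, and adds \<open>e\<close> to the kernel; the induction is on the codimension of
the kernel.\<close>
lemma psd_sum_of_squares:
  fixes F :: "'a::euclidean_space \<Rightarrow> 'a"
  assumes "linear F" and "\<And>x y. x \<bullet> F y = F x \<bullet> y" and "\<And>x. 0 \<le> x \<bullet> F x"
  shows "\<exists>(n::nat) v. \<forall>x. F x = (\<Sum>k<n. (v k \<bullet> x) *\<^sub>R v k)"
  using assms
proof (induction "DIM('a) - dim {x. F x = 0}" arbitrary: F rule: less_induct)
  case less
  note lin = less.prems(1) and sym = less.prems(2) and psd = less.prems(3)
  show ?case
  proof (cases "\<exists>e. e \<bullet> F e > 0")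
    case False
    have "F x = 0" for x
    proof -
      have zero: "y \<bullet> F y = 0" for y
        using False psd[of y] by (meson antisym not_le)
      have "0 = (x + F x) \<bullet> F (x + F x)"
        by (simp add: zero)
      also have "\<dots> = 2 * (F x \<bullet> F x)"
        using zero[of x] zero[of "F x"] sym[of x "F x"]
        by (simp add: linear_add[OF lin] inner_add_left inner_add_right inner_commute)
      finally show ?thesis by simp
    qed
    then show ?thesis
      by (intro exI[of _ 0]) simp
  next
    case True
    then obtain e where e: "e \<bullet> F e > 0" by blast
    define w where "w = (1 / sqrt (e \<bullet> F e)) *\<^sub>R F e"
    define F' where "F' x = F x - (w \<bullet> x) *\<^sub>R w" for x
    have F'_alt: "F' x = F x - ((e \<bullet> F x) / (e \<bullet> F e)) *\<^sub>R F e" for x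
      using e by (simp add: F'_def w_def sym[of e x])
    have lin': "linear F'"
      by (rule linearI)
        (simp_all add: F'_def linear_add[OF lin] linear_scale[OF lin] algebra_simps inner_add_right)
    have sym': "x \<bullet> F' y = F' x \<bullet> y" for x y
      by (simp add: F'_def inner_diff_left inner_diff_right sym[of x y] inner_commute[of w])
    have psd': "0 \<le> x \<bullet> F' x" for x
    proof -
      define s where "s = (e \<bullet> F x) / (e \<bullet> F e)"
      have se: "s * (e \<bullet> F e) = e \<bullet> F x" using e by (simp add: s_def)
      have xe: "x \<bullet> F e = e \<bullet> F x" by (metis sym inner_commute)
      have "0 \<le> (x - s *\<^sub>R e) \<bullet> F (x - s *\<^sub>R e)" by (rule psd)
      also have "\<dots> = x \<bullet> F x - s * (x \<bullet> F e) - s * (e \<bullet> F x) + s * (s * (e \<bullet> F e))"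
        by (simp add: linear_diff[OF lin] linear_scale[OF lin] inner_diff_left inner_diff_right algebra_simps)
      also have "\<dots> = x \<bullet> F' x"
        unfolding se xe by (simp add: F'_alt inner_diff_right xe s_def[symmetric])
      finally show ?thesis .
    qed
    have "{x. F x = 0} \<subset> {x. F' x = 0}"
    proof
      show "{x. F x = 0} \<subseteq> {x. F' x = 0}" by (auto simp: F'_alt)
      have "F' e = 0" "F e \<noteq> 0" using e by (auto simp: F'_alt)
      then show "{x. F x = 0} \<noteq> {x. F' x = 0}" by auto
    qed
    then have "dim {x. F x = 0} < dim {x. F' x = 0}"
      using linear_subspace_kernel[OF lin] linear_subspace_kernel[OF lin']
      by (intro dim_psubset) (simp add: span_eq_iff[THEN iffD2])
    moreover have "dim {x. F' x = 0} \<le> DIM('a)"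
      by (rule dim_subset_UNIV)
    ultimately have "DIM('a) - dim {x. F' x = 0} < DIM('a) - dim {x. F x = 0}"
      by linarith
    from less.hyps[OF this lin' sym' psd'] obtain n :: nat and v
      where nv: "\<forall>x. F' x = (\<Sum>k<n. (v k \<bullet> x) *\<^sub>R v k)" by (elim exE)
    have "F x = (\<Sum>k<Suc n. ((v(n := w)) k \<bullet> x) *\<^sub>R (v(n := w)) k)" for x
    proof -
      have "(\<Sum>k<n. ((v(n := w)) k \<bullet> x) *\<^sub>R (v(n := w)) k) = F' x"
        unfolding nv[rule_format] by (intro sum.cong) auto
      then show ?thesis by (simp add: F'_def)
    qed
    then have "\<forall>x. F x = (\<Sum>k<Suc n. ((v(n := w)) k \<bullet> x) *\<^sub>R (v(n := w)) k)" ..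
    then show ?thesis by (rule exI[of _ "Suc n", OF exI[of _ "v(n := w)"]])
  qed
qed

section \<open>Steering under a drift with non-positive spectral bound\<close>

text \<open>The control system is \<open>\<eta>' = f(\<eta>) + b\<close> with energy \<open>\<integral> |b|\<^sup>2\<close>. The function \<open>c\<close> bounds the energy
still to be spent after time \<open>t\<close>; using any such bound in place of the integral makes the notion
stable under sums of paths and is the form in which the maximum principle uses it. The path may
take infinite time to reach the origin, so that finite sums of decaying exponentials suffice.\<close>
definition cheaply_steerable :: "('a::real_normed_vector \<Rightarrow> 'a) \<Rightarrow> 'a \<Rightarrow> bool" where
  "cheaply_steerable f x \<longleftrightarrow> (\<forall>e>0. \<exists>\<eta> \<eta>' c c'.
    (\<forall>t\<ge>0. (\<eta> has_vector_derivative \<eta>' t) (at t)) \<and> \<eta> 0 = x \<and> (\<eta> \<longlongrightarrow> 0) at_top \<and>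
    (\<forall>t\<ge>0. (c has_real_derivative c' t) (at t)) \<and> (\<forall>t\<ge>0. 0 \<le> c t) \<and> c 0 \<le> (e::real) \<and>
    (\<forall>t\<ge>0. (norm (\<eta>' t - f (\<eta> t)))\<^sup>2 \<le> - c' t))"

text \<open>The vector \<open>p(M) x\<close>, by Horner's scheme.\<close>
definition poly_apply :: "complex poly \<Rightarrow> complex^'n^'n \<Rightarrow> complex^'n \<Rightarrow> complex^'n" where
  "poly_apply p M x = fold_coeffs (\<lambda>a y. a *s x + M *v y) p 0"

lemma poly_apply_0 [simp]: "poly_apply 0 M x = 0"
  by (simp add: poly_apply_def)

lemma poly_apply_pCons [simp]: "poly_apply (pCons a p) M x = a *s x + M *v poly_apply p M x"
  by (cases "a = 0 \<and> p = 0") (auto simp: poly_apply_def)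

lemma poly_apply_add: "poly_apply (p + r) M x = poly_apply p M x + poly_apply r M x"
  by (induction p r rule: poly_induct2)
    (simp_all add: vector_sadd_rdistrib matrix_vector_right_distrib)

lemma poly_apply_smult: "poly_apply (smult c p) M x = c *s poly_apply p M x"
  by (induction p) (simp_all add: vector_add_ldistrib vector_scalar_commute)

lemma poly_apply_sum: "poly_apply (sum p S) M x = (\<Sum>i\<in>S. poly_apply (p i) M x)"
  by (induction S rule: infinite_finite_induct) (simp_all add: poly_apply_add)

lemma poly_apply_monom: "poly_apply (monom c k) M x = c *s (((*v) M) ^^ k) x"
  by (induction k) (simp_all add: monom_0 monom_Suc vector_scalar_commute)

text \<open>The operator \<open>p(M)\<close> commutes with \<open>M - z\<close>, so a preimage of \<open>x\<close> under \<open>M - z\<close> yields one of \<open>p(M) x\<close>.\<close>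
lemma poly_apply_commute:
  "poly_apply p M (M *v x - z *s x) = M *v poly_apply p M x - z *s poly_apply p M x"
proof (induction p)
  case (pCons a p)
  show ?case
    unfolding poly_apply_pCons pCons.IH
    by (simp add: vector_scalar_commute matrix_vector_right_distrib matrix_vector_mult_diff_distrib
        vector_add_ldistrib vector_ssub_ldistrib vector_smult_assoc mult.commute)
qed simp

lemma poly_apply_linear_factor:
  "poly_apply ([:- z, 1:] * p) M x = M *v poly_apply p M x - z *s poly_apply p M x"
proof -
  have "[:- z, 1:] * p = pCons 0 p + smult (- z) p" by simp
  then show ?thesis
    by (simp only: poly_apply_add poly_apply_smult poly_apply_pCons) simp
qed

lemma poly_apply_eigenvector:
  assumes "M *v x = z *s x"
  shows "poly_apply p M x = poly p z *s x"
  by (induction p)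
    (simp_all add: vector_scalar_commute assms vector_sadd_rdistrib mult.commute)

lemma sequence_dependent:
  fixes B :: "nat \<Rightarrow> 'a::euclidean_space"
  shows "\<exists>N r. (\<exists>i\<le>N. r i \<noteq> (0::real)) \<and> (\<Sum>i\<le>N. r i *\<^sub>R B i) = 0"
proof (cases "inj_on B {..DIM('a)}")
  case True
  then have "card (B ` {..DIM('a)}) > DIM('a)"
    by (simp add: card_image)
  then have "dependent (B ` {..DIM('a)})"
    by (intro dependent_biggerset) auto
  then obtain c where "\<exists>w\<in>B ` {..DIM('a)}. c w \<noteq> 0" "(\<Sum>w\<in>B ` {..DIM('a)}. c w *\<^sub>R w) = 0"
    by (subst (asm) real_vector.dependent_finite) auto
  then show ?thesis
    using True by (intro exI[of _ "DIM('a)"] exI[of _ "c \<circ> B"]) (auto simp: sum.reindex)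
next
  case False
  then obtain i j where ij: "i \<le> DIM('a)" "j \<le> DIM('a)" "i \<noteq> j" "B i = B j"
    by (auto simp: inj_on_def)
  let ?r = "\<lambda>k. (if k = i then 1 else 0) - (if k = j then 1 else 0) :: real"
  have "(\<Sum>k\<le>DIM('a). ?r k *\<^sub>R B k)
      = (\<Sum>k\<le>DIM('a). if k = i then B k else 0) - (\<Sum>k\<le>DIM('a). if k = j then B k else 0)"
    unfolding sum_subtractf[symmetric] by (intro sum.cong) (auto simp: algebra_simps)
  also have "\<dots> = 0"
    using ij by (simp add: sum.delta)
  finally show ?thesis
    using ij by (intro exI[of _ "DIM('a)"] exI[of _ ?r]) auto
qed

lemma of_real_vector_scalar_mult: "complex_of_real r *s x = r *\<^sub>R (x :: complex^'n)"
  by (simp add: vec_eq_iff scaleR_conv_of_real[where 'a = complex])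

text \<open>The powers of \<open>M\<close> live in a finite-dimensional real space and are therefore linearly dependent.\<close>
lemma annihilating_polynomial:
  fixes M :: "complex^'n^'n"
  obtains p where "p \<noteq> 0" "\<And>x. poly_apply p M x = 0"
proof -
  define B where "B k = (((**) M) ^^ k) (mat 1)" for k
  have B: "B k *v x = (((*v) M) ^^ k) x" for k x
    by (induction k) (simp_all add: B_def matrix_vector_mul_assoc[symmetric])
  obtain N r i where r: "i \<le> N" "r i \<noteq> 0" "(\<Sum>k\<le>N. r k *\<^sub>R B k) = 0"
    using sequence_dependent[of B] by blast
  define p where "p = (\<Sum>k\<le>N. monom (complex_of_real (r k)) k)"
  have "coeff p i = complex_of_real (r i)"
    using r(1) by (simp add: p_def coeff_sum sum.delta)
  then have "p \<noteq> 0" using r(2) by auto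
  moreover have "poly_apply p M x = 0" for x
  proof -
    have "poly_apply p M x = (\<Sum>k\<le>N. r k *\<^sub>R (B k *v x))"
      by (simp add: p_def poly_apply_sum poly_apply_monom B of_real_vector_scalar_mult)
    also have "\<dots> = (\<Sum>k\<le>N. r k *\<^sub>R B k) *v x"
    proof -
      have [simp]: "(a *\<^sub>R L) *v x = a *\<^sub>R (L *v x)" for a and L :: "complex^'n^'n"
        by (simp add: vec_eq_iff matrix_vector_mult_def scaleR_sum_right)
      have "(\<Sum>k\<in>S. r k *\<^sub>R (B k *v x)) = (\<Sum>k\<in>S. r k *\<^sub>R B k) *v x" for S
        by (induction S rule: infinite_finite_induct)
          (simp_all add: matrix_vector_mult_add_rdistrib)
      then show ?thesis .
    qed
    finally show ?thesis by (simp add: r(3))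
  qed
  ultimately show thesis by (rule that)
qed

lemma norm_vector_scalar_mult_complex: "norm (z *s x) = cmod z * norm (x :: complex^'n)"
  by (simp add: norm_vec_def norm_mult L2_set_right_distrib)

text \<open>In finite dimension \<open>M - z\<close> is onto as soon as \<open>z\<close> is not an eigenvalue.\<close>
lemma resolvent_surjective:
  fixes M :: "complex^'n^'n"
  assumes "\<And>x. M *v x = z *s x \<Longrightarrow> x = 0"
  shows "\<exists>y. M *v y - z *s y = x"
proof -
  let ?f = "\<lambda>y. M *v y - z *s y"
  have "linear ?f"
  proof (rule linearI)
    show "?f (x + y) = ?f x + ?f y" for x y
      by (simp add: matrix_vector_right_distrib vector_add_ldistrib)
    show "?f (r *\<^sub>R y) = r *\<^sub>R ?f y" for r y
      unfolding of_real_vector_scalar_mult[symmetric] vector_scalar_commute vector_ssub_ldistrib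
        vector_smult_assoc by (simp only: mult.commute)
  qed
  moreover have "inj ?f"
    unfolding linear_injective_0[OF \<open>linear ?f\<close>] right_minus_eq using assms by blast
  ultimately have "surj ?f"
    by (rule linear_inj_imp_surj)
  then obtain y where "x = ?f y"
    by (rule surjE)
  then show ?thesis by (intro exI[of _ y]) simp
qed

lemma exponential_path_derivative:
  "((\<lambda>t. exp (of_real t * z) *s y) has_vector_derivative (exp (of_real t * z) * z) *s (y :: complex^'n)) (at t)"
proof -
  have "linear (\<lambda>w. w *s y)"
    by (rule linearI) (simp_all add: vector_sadd_rdistrib vec_eq_iff)
  then have "bounded_linear (\<lambda>w. w *s y)"
    by (simp add: linear_conv_bounded_linear)
  moreover have "((\<lambda>t. exp (of_real t * z)) has_vector_derivative exp (of_real t * z) * z) (at t)"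
    by (rule has_vector_derivative_real_field) (auto intro!: derivative_eq_intros)
  ultimately show ?thesis
    by (rule bounded_linear.has_vector_derivative)
qed

lemma cheaply_steerable_0: "cheaply_steerable ((*v) M) (0 :: complex^'n)"
  unfolding cheaply_steerable_def
  by (intro allI impI exI[of _ "\<lambda>_. 0"]) simp

text \<open>If \<open>(M - z + \<delta>)y = x\<close> then \<open>x = (M - z)y + \<delta>y\<close>. The path \<open>exp (t(z - \<delta>)) \<delta>y\<close> starts at the second
summand and has control \<open>- \<delta> exp (t(z - \<delta>)) x\<close>, whose total energy is at most \<open>\<delta> |x|\<^sup>2 / 2\<close> because
\<open>Re z \<le> 0\<close>; this bound does not involve \<open>y\<close>, which may blow up as \<open>\<delta>\<close> tends to \<open>0\<close>.\<close>
lemma cheaply_steerable_resolvent: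
  fixes M :: "complex^'n^'n"
  assumes "Re z \<le> 0"
    and res: "\<And>d. d > 0 \<Longrightarrow> \<exists>\<delta> y. 0 < \<delta> \<and> \<delta> < d \<and>
      M *v y - (z - of_real \<delta>) *s y = x \<and> cheaply_steerable ((*v) M) (M *v y - z *s y)"
  shows "cheaply_steerable ((*v) M) x"
  unfolding cheaply_steerable_def
proof (intro allI impI)
  fix e :: real assume "e > 0"
  have x1: "(norm x)\<^sup>2 + 1 > 0" by (simp add: add_nonneg_pos)
  then have "e / (2 * ((norm x)\<^sup>2 + 1)) > 0" using \<open>e > 0\<close> by simp
  then obtain \<delta> y where \<delta>: "0 < \<delta>" "\<delta> < e / (2 * ((norm x)\<^sup>2 + 1))"
    and y: "M *v y - (z - of_real \<delta>) *s y = x" and cheap: "cheaply_steerable ((*v) M) (M *v y - z *s y)"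
    using res by blast
  obtain \<eta> \<eta>' c c' where
    1: "\<And>t. t \<ge> 0 \<Longrightarrow> (\<eta> has_vector_derivative \<eta>' t) (at t)" "\<eta> 0 = M *v y - z *s y" "(\<eta> \<longlongrightarrow> 0) at_top"
      "\<And>t. t \<ge> 0 \<Longrightarrow> (c has_real_derivative c' t) (at t)" "\<And>t. t \<ge> 0 \<Longrightarrow> 0 \<le> c t" "c 0 \<le> e / 4"
      "\<And>t. t \<ge> 0 \<Longrightarrow> (norm (\<eta>' t - M *v \<eta> t))\<^sup>2 \<le> - c' t"
    using cheap[unfolded cheaply_steerable_def, rule_format, of "e / 4"] \<open>e > 0\<close> by auto
  define \<mu> where "\<mu> = z - of_real \<delta>"
  define w where "w = of_real \<delta> *s y"
  define \<gamma> where "\<gamma> t = exp (of_real t * \<mu>) *s w" for t :: real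
  define \<gamma>' where "\<gamma>' t = (exp (of_real t * \<mu>) * \<mu>) *s w" for t :: real
  define b where "b t = \<delta> * (norm x)\<^sup>2 / 2 * exp (- 2 * \<delta> * t)" for t
  define b' where "b' t = - (\<delta> * norm x * exp (- \<delta> * t))\<^sup>2" for t
  have decay: "cmod (exp (of_real t * \<mu>)) \<le> exp (- \<delta> * t)" if "t \<ge> 0" for t
  proof -
    have "t * Re z \<le> 0" using that assms(1) by (simp add: mult_nonneg_nonpos)
    then show ?thesis by (simp add: \<mu>_def algebra_simps)
  qed
  have \<gamma>: "(\<gamma> has_vector_derivative \<gamma>' t) (at t)" for t
    unfolding \<gamma>_def \<gamma>'_def by (rule exponential_path_derivative)
  have b: "(b has_real_derivative b' t) (at t)" for t
    unfolding b_def b'_def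
    by (auto intro!: derivative_eq_intros simp: power2_eq_square algebra_simps simp flip: exp_add)
  have residual: "(norm (\<gamma>' t - M *v \<gamma> t))\<^sup>2 \<le> - b' t" if "t \<ge> 0" for t
  proof -
    have "M *v y = x + \<mu> *s y" using y by (simp add: \<mu>_def algebra_simps)
    then have "\<gamma>' t - M *v \<gamma> t = (- exp (of_real t * \<mu>) * of_real \<delta>) *s x"
      by (simp add: \<gamma>_def \<gamma>'_def w_def vector_scalar_commute vec_eq_iff algebra_simps)
    then have "norm (\<gamma>' t - M *v \<gamma> t) = cmod (exp (of_real t * \<mu>)) * (\<delta> * norm x)"
      using \<delta>(1) by (simp only: norm_vector_scalar_mult_complex norm_mult norm_minus_cancel) simp
    also have "\<dots> \<le> exp (- \<delta> * t) * (\<delta> * norm x)"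
      using decay[OF that] \<delta>(1) by (intro mult_right_mono) auto
    finally have "(norm (\<gamma>' t - M *v \<gamma> t))\<^sup>2 \<le> (exp (- \<delta> * t) * (\<delta> * norm x))\<^sup>2"
      by (intro power_mono) auto
    then show ?thesis by (simp add: b'_def mult.commute)
  qed
  have \<gamma>_lim: "(\<gamma> \<longlongrightarrow> 0) at_top"
  proof (rule Lim_null_comparison)
    show "\<forall>\<^sub>F t in at_top. norm (\<gamma> t) \<le> exp (- \<delta> * t) * norm w"
      using eventually_ge_at_top[of 0]
      by eventually_elim (use decay in \<open>auto simp: \<gamma>_def norm_vector_scalar_mult_complex intro!: mult_right_mono\<close>)
    have "filterlim (\<lambda>t. - \<delta> * t) at_bot at_top"
      using \<delta>(1) by (intro filterlim_tendsto_neg_mult_at_bot[OF tendsto_const] filterlim_ident) auto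
    then have "((\<lambda>t. exp (- \<delta> * t)) \<longlongrightarrow> 0) at_top"
      by (rule filterlim_compose[OF exp_at_bot])
    then show "((\<lambda>t. exp (- \<delta> * t) * norm w) \<longlongrightarrow> 0) at_top"
      by (rule tendsto_mult_left_zero)
  qed
  have small: "b 0 \<le> e / 4"
  proof -
    have "\<delta> * (norm x)\<^sup>2 \<le> \<delta> * ((norm x)\<^sup>2 + 1)" using \<delta>(1) by simp
    also have "\<dots> \<le> e / 2" using \<delta>(2) x1 by (simp add: field_simps)
    finally show ?thesis by (simp add: b_def)
  qed
  show "\<exists>\<eta> \<eta>' c c'. (\<forall>t\<ge>0. (\<eta> has_vector_derivative \<eta>' t) (at t)) \<and> \<eta> 0 = x \<and> (\<eta> \<longlongrightarrow> 0) at_top \<and>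
      (\<forall>t\<ge>0. (c has_real_derivative c' t) (at t)) \<and> (\<forall>t\<ge>0. 0 \<le> c t) \<and> c 0 \<le> e \<and>
      (\<forall>t\<ge>0. (norm (\<eta>' t - M *v \<eta> t))\<^sup>2 \<le> - c' t)"
  proof (intro exI conjI allI impI)
    fix t :: real assume t: "t \<ge> 0"
    show "((\<lambda>t. \<eta> t + \<gamma> t) has_vector_derivative \<eta>' t + \<gamma>' t) (at t)"
      by (intro has_vector_derivative_add 1 \<gamma> t)
    show "((\<lambda>t. 2 * c t + 2 * b t) has_real_derivative 2 * c' t + 2 * b' t) (at t)"
      by (intro DERIV_add DERIV_cmult 1 b t)
    show "0 \<le> 2 * c t + 2 * b t"
      using 1(5)[OF t] \<delta>(1) by (simp add: b_def)
    have "\<eta>' t + \<gamma>' t - M *v (\<eta> t + \<gamma> t) = (\<eta>' t - M *v \<eta> t) + (\<gamma>' t - M *v \<gamma> t)"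
      by (simp add: matrix_vector_right_distrib)
    then have "norm (\<eta>' t + \<gamma>' t - M *v (\<eta> t + \<gamma> t))
        \<le> norm (\<eta>' t - M *v \<eta> t) + norm (\<gamma>' t - M *v \<gamma> t)"
      by (simp only: norm_triangle_ineq)
    then have "(norm (\<eta>' t + \<gamma>' t - M *v (\<eta> t + \<gamma> t)))\<^sup>2
        \<le> (norm (\<eta>' t - M *v \<eta> t) + norm (\<gamma>' t - M *v \<gamma> t))\<^sup>2"
      by (intro power_mono) auto
    also have "\<dots> \<le> 2 * (norm (\<eta>' t - M *v \<eta> t))\<^sup>2 + 2 * (norm (\<gamma>' t - M *v \<gamma> t))\<^sup>2"
      using zero_le_power2[of "norm (\<eta>' t - M *v \<eta> t) - norm (\<gamma>' t - M *v \<gamma> t)"]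
      by (simp add: power2_sum power2_diff)
    also have "\<dots> \<le> - (2 * c' t + 2 * b' t)"
      using 1(7)[OF t] residual[OF t] by simp
    finally show "(norm (\<eta>' t + \<gamma>' t - M *v (\<eta> t + \<gamma> t)))\<^sup>2 \<le> - (2 * c' t + 2 * b' t)" .
  next
    have "M *v y = x + (z - of_real \<delta>) *s y" using y by (simp add: algebra_simps)
    then show "\<eta> 0 + \<gamma> 0 = x"
      by (simp add: 1(2) \<gamma>_def w_def vec_eq_iff algebra_simps)
    show "((\<lambda>t. \<eta> t + \<gamma> t) \<longlongrightarrow> 0) at_top"
      using tendsto_add[OF 1(3) \<gamma>_lim] by simp
    show "2 * c 0 + 2 * b 0 \<le> e"
      using 1(6) small by simp
  qed
qed

text \<open>Every eigenvalue is a root of an annihilating polynomial.\<close>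
lemma finite_eigenvalues: "finite {z. \<exists>x. x \<noteq> 0 \<and> M *v x = z *s (x :: complex^'n)}"
proof -
  obtain p where p: "p \<noteq> 0" "\<And>x. poly_apply p M x = 0"
    by (rule annihilating_polynomial[of M]) blast
  have "{z. \<exists>x. x \<noteq> 0 \<and> M *v x = z *s x} \<subseteq> {z. poly p z = 0}"
    using p(2) poly_apply_eigenvector[of M _ _ p] by (fastforce simp: vector_mul_eq_0)
  then show ?thesis
    using poly_roots_finite[OF p(1)] finite_subset by blast
qed

text \<open>If the range of \<open>p(M)\<close> can be steered cheaply and \<open>p = (X - z) r\<close>, so can the range of \<open>r(M)\<close>: either
\<open>z\<close> is not an eigenvalue and the two ranges coincide, or \<open>Re z \<le> 0\<close> and the resolvent splitting
applies. Removing all linear factors from an annihilating polynomial leaves a constant, whose range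
is the whole space.\<close>
lemma cheaply_steerable_complex:
  fixes M :: "complex^'n^'n"
  assumes spec: "\<And>z x. x \<noteq> 0 \<Longrightarrow> M *v x = z *s x \<Longrightarrow> Re z \<le> 0"
  shows "cheaply_steerable ((*v) M) x"
proof -
  have "\<forall>x. cheaply_steerable ((*v) M) x"
    if "p \<noteq> 0" "\<And>x. cheaply_steerable ((*v) M) (poly_apply p M x)" for p
    using that
  proof (induction "degree p" arbitrary: p)
    case 0
    then obtain a where "p = [:a:]" by (metis degree_0_id)
    then have "a \<noteq> 0" "poly_apply p M (inverse a *s x) = x" for x
      using 0 by auto
    then show ?case using 0(3) by metis
  next
    case (Suc m)
    have "\<not> constant (poly p)"
      using Suc.hyps(2) by (simp add: constant_degree)
    then obtain z where "poly p z = 0"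
      using fundamental_theorem_of_algebra by blast
    then obtain r where r: "p = [:- z, 1:] * r"
      by (meson poly_eq_0_iff_dvd dvdE)
    have "r \<noteq> 0" using r Suc.prems(1) by auto
    then have deg: "m = degree r"
      using Suc.hyps(2) unfolding r by (subst (asm) degree_mult_eq) auto
    have cheap: "cheaply_steerable ((*v) M) (M *v poly_apply r M y - z *s poly_apply r M y)" for y
      using Suc.prems(2)[of y] unfolding r poly_apply_linear_factor .
    have "cheaply_steerable ((*v) M) (poly_apply r M x)" for x
    proof (cases "\<exists>x. x \<noteq> 0 \<and> M *v x = z *s x")
      case False
      then obtain y where "M *v y - z *s y = x"
        using resolvent_surjective[of M z x] by blast
      then have "poly_apply r M x = M *v poly_apply r M y - z *s poly_apply r M y"
        using poly_apply_commute[of r M y z] by simp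
      then show ?thesis using cheap[of y] by simp
    next
      case True
      show ?thesis
      proof (rule cheaply_steerable_resolvent)
        show "Re z \<le> 0" using True spec by blast
        fix d :: real assume "d > 0"
        let ?S = "{z. \<exists>x. x \<noteq> 0 \<and> M *v x = z *s x}"
        \<comment> \<open>\<open>\<delta>\<close> has to avoid the finitely many values for which \<open>z - \<delta>\<close> is an eigenvalue\<close>
        have "finite ((\<lambda>\<delta>. z - complex_of_real \<delta>) -` ?S)"
          by (intro finite_vimageI finite_eigenvalues) (auto simp: inj_def)
        moreover have "infinite {0<..<d}" using \<open>d > 0\<close> by (simp add: infinite_Ioo)
        ultimately have "\<not> {0<..<d} \<subseteq> (\<lambda>\<delta>. z - complex_of_real \<delta>) -` ?S"
          using finite_subset by blast
        then obtain \<delta> where \<delta>: "0 < \<delta>" "\<delta> < d" "z - complex_of_real \<delta> \<notin> ?S"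
          unfolding subset_iff vimage_eq greaterThanLessThan_iff by blast
        then obtain y where "M *v y - (z - of_real \<delta>) *s y = x"
          using resolvent_surjective[of M "z - of_real \<delta>" x] by blast
        then have "M *v poly_apply r M y - (z - of_real \<delta>) *s poly_apply r M y = poly_apply r M x"
          using poly_apply_commute[of r M y "z - of_real \<delta>"] by simp
        then show "\<exists>\<delta> y. 0 < \<delta> \<and> \<delta> < d \<and> M *v y - (z - of_real \<delta>) *s y = poly_apply r M x
            \<and> cheaply_steerable ((*v) M) (M *v y - z *s y)"
          using \<delta> cheap by blast
      qed
    qed
    then show ?case
      using Suc.hyps(1)[OF deg \<open>r \<noteq> 0\<close>] by blast
  qed
  moreover obtain p where "p \<noteq> 0" "\<And>x. poly_apply p M x = 0"
    by (rule annihilating_polynomial[of M]) blast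
  ultimately show ?thesis
    by (metis cheaply_steerable_0)
qed

text \<open>The real part of a complex steering path is a steering path for the real matrix, with no more
energy. Finiteness of the spectrum turns the bound on its maximal real part into a bound for every
eigenvalue.\<close>
proposition cheaply_steerable_real:
  fixes A :: "real^'n^'n"
  assumes "spectral_bound A \<le> 0"
  shows "cheaply_steerable ((*v) A) h"
proof -
  let ?M = "map_matrix complex_of_real A"
  define P :: "complex^'n \<Rightarrow> real^'n" where "P z = (\<chi> i. Re (z $ i))" for z
  have finite_spec: "finite (complex_spectrum A)"
    unfolding complex_spectrum_def by (rule finite_eigenvalues)
  have "Re z \<le> 0" if "x \<noteq> 0" "?M *v x = z *s x" for z x
  proof -
    have "z \<in> complex_spectrum A"
      unfolding complex_spectrum_def using that by blast
    then have "Re z \<le> spectral_bound A"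
      unfolding spectral_bound_def using finite_spec by (intro Max_ge) auto
    then show ?thesis using assms by simp
  qed
  then have cheap: "cheaply_steerable ((*v) ?M) (\<chi> i. complex_of_real (h $ i))"
    by (rule cheaply_steerable_complex)
  have "linear P"
    by (rule linearI) (simp_all add: P_def vec_eq_iff)
  then have blP: "bounded_linear P"
    by (simp add: linear_conv_bounded_linear)
  have P_M: "P (?M *v z) = A *v P z" for z
    by (simp add: P_def vec_eq_iff matrix_vector_mult_def)
  have P_norm: "norm (P z) \<le> norm z" for z
    unfolding norm_vec_def by (rule L2_set_mono) (simp_all add: P_def abs_Re_le_cmod)
  show ?thesis
    unfolding cheaply_steerable_def
  proof (intro allI impI)
    fix e :: real assume "e > 0"
    then obtain \<eta> \<eta>' c c' where
      1: "\<forall>t\<ge>0. (\<eta> has_vector_derivative \<eta>' t) (at t)" "\<eta> 0 = (\<chi> i. complex_of_real (h $ i))"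
        "(\<eta> \<longlongrightarrow> 0) at_top"
        "\<forall>t\<ge>0. (c has_real_derivative c' t) (at t)" "\<forall>t\<ge>0. 0 \<le> c t" "c 0 \<le> e"
        "\<forall>t\<ge>0. (norm (\<eta>' t - ?M *v \<eta> t))\<^sup>2 \<le> - c' t"
      using cheap[unfolded cheaply_steerable_def, rule_format, of e] by blast
    show "\<exists>\<eta> \<eta>' c c'. (\<forall>t\<ge>0. (\<eta> has_vector_derivative \<eta>' t) (at t)) \<and> \<eta> 0 = h \<and> (\<eta> \<longlongrightarrow> 0) at_top \<and>
      (\<forall>t\<ge>0. (c has_real_derivative c' t) (at t)) \<and> (\<forall>t\<ge>0. 0 \<le> c t) \<and> c 0 \<le> e \<and>
      (\<forall>t\<ge>0. (norm (\<eta>' t - A *v \<eta> t))\<^sup>2 \<le> - c' t)"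
    proof (intro exI conjI)
      show "\<forall>t\<ge>0. ((\<lambda>t. P (\<eta> t)) has_vector_derivative P (\<eta>' t)) (at t)"
        using 1(1) bounded_linear.has_vector_derivative[OF blP] by blast
      show "P (\<eta> 0) = h" by (simp add: 1(2) P_def vec_eq_iff)
      show "((\<lambda>t. P (\<eta> t)) \<longlongrightarrow> 0) at_top"
        by (rule bounded_linear.tendsto_zero[OF blP 1(3)])
      show "\<forall>t\<ge>0. (norm (P (\<eta>' t) - A *v P (\<eta> t)))\<^sup>2 \<le> - c' t"
      proof (intro allI impI)
        fix t :: real assume "t \<ge> 0"
        have "P (\<eta>' t) - A *v P (\<eta> t) = P (\<eta>' t - ?M *v \<eta> t)"
          by (simp add: linear_diff[OF \<open>linear P\<close>] P_M)
        then have "(norm (P (\<eta>' t) - A *v P (\<eta> t)))\<^sup>2 \<le> (norm (\<eta>' t - ?M *v \<eta> t))\<^sup>2"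
          by (simp add: P_norm power_mono)
        then show "(norm (P (\<eta>' t) - A *v P (\<eta> t)))\<^sup>2 \<le> - c' t"
          using 1(7) \<open>t \<ge> 0\<close> order_trans by blast
      qed
    qed (use 1 in blast)+
  qed
qed

section \<open>The maximum principle for coupled solutions\<close>

text \<open>If \<open>Q = \<Sum>k<n. v k (v k)\<^sup>T\<close> then \<open>tr (Q D\<^sup>2u) = \<Sum>k<n. D\<^sup>2u(v k, v k)\<close>. Writing the second-order part as
a sum of pure second derivatives along the \<open>v k\<close> reduces the maximum principle to the
second-derivative test on lines. The number \<open>q\<close> is an ellipticity constant of \<open>Q\<close>.\<close>
locale positive_ou_solution =
  fixes v :: "nat \<Rightarrow> 'a::euclidean_space" and n :: nat and A :: "'a \<Rightarrow> 'a"
    and u :: "'a \<Rightarrow> real" and g :: "'a \<Rightarrow> 'a" and H :: "'a \<Rightarrow> 'a \<Rightarrow> 'a" and q c0 :: real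
  assumes lin: "linear A"
    and q_pos: "q > 0"
    and elliptic: "\<And>d. q * (norm d)\<^sup>2 \<le> (\<Sum>k<n. (d \<bullet> v k)\<^sup>2)"
    and gradient: "\<And>x. (u has_derivative (\<lambda>h. g x \<bullet> h)) (at x)"
    and hessian: "\<And>x. (g has_derivative H x) (at x)"
    and harmonic: "\<And>x. (\<Sum>k<n. H x (v k) \<bullet> v k) / 2 + g x \<bullet> A x = 0"
    and growth: "c0 > 0" "\<And>x. u x \<le> c0 * exp (c0 * norm x)"
    and pos: "\<And>x. u x > 0"
begin

lemma derivative_along_curve:
  assumes "(\<gamma> has_vector_derivative w) (at t)"
  shows "((\<lambda>t. u (\<gamma> t)) has_real_derivative g (\<gamma> t) \<bullet> w) (at t)"
proof -
  have "((u \<circ> \<gamma>) has_derivative (\<lambda>h. g (\<gamma> t) \<bullet> h) \<circ> (\<lambda>h. h *\<^sub>R w)) (at t)"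
    using assms gradient unfolding has_vector_derivative_def by (rule diff_chain_at)
  then show ?thesis
    by (simp add: has_field_derivative_def o_def mult_commute_abs)
qed

lemma derivative_along_line:
  "((\<lambda>s. u (x + s *\<^sub>R w)) has_real_derivative g (x + s *\<^sub>R w) \<bullet> w) (at s)"
  by (rule derivative_along_curve) (auto intro!: derivative_eq_intros)

lemma second_derivative_along_line:
  "((\<lambda>s. g (x + s *\<^sub>R w) \<bullet> w) has_real_derivative H x w \<bullet> w) (at 0)"
proof -
  have "((g \<circ> (\<lambda>s. x + s *\<^sub>R w)) has_derivative H x \<circ> (\<lambda>s. s *\<^sub>R w)) (at 0)"
    by (rule diff_chain_at) (auto intro!: derivative_eq_intros simp: hessian)
  then have "((\<lambda>s. g (x + s *\<^sub>R w) \<bullet> w) has_derivative (\<lambda>s. H x (s *\<^sub>R w) \<bullet> w)) (at 0)"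
    by (auto intro!: derivative_eq_intros simp: o_def)
  moreover have "H x (s *\<^sub>R w) = s *\<^sub>R H x w" for s
    using has_derivative_linear[OF hessian] by (rule linear_scale)
  ultimately show ?thesis
    by (simp add: has_field_derivative_def mult_commute_abs)
qed

lemma continuous_u: "continuous_on S u"
  using gradient by (intro continuous_at_imp_continuous_on) (blast dest: has_derivative_continuous)

text \<open>The left-hand side is \<open>(\<partial>\<^sub>t + L) G / G\<close> at one point, for \<open>G = sqrt (u(x + \<eta>) u(x - \<eta>)) exp c\<close> with
\<open>\<eta> = h\<close>, \<open>\<eta>' = w\<close> and \<open>c' = \<kappa>\<close>. With \<open>d\<close> the difference of the logarithmic gradients of \<open>u\<close> at the two
points and \<open>\<beta> = w - A h\<close> the control, the equation for \<open>u\<close> reduces it to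
\<open>d \<bullet> \<beta> / 2 + \<kappa> - (d \<bullet> Q d) / 8\<close>; the gain \<open>- (d \<bullet> Q d) / 8\<close> comes from averaging logarithms and absorbs
the first term at the price of \<open>|\<beta>|\<^sup>2 / (2q)\<close>.\<close>
lemma generator_of_geometric_mean_nonpos:
  fixes x h w :: 'a
  defines "a \<equiv> g (x + h)" and "b \<equiv> g (x - h)" and "U \<equiv> u (x + h)" and "W \<equiv> u (x - h)"
  assumes w: "(norm (w - A h))\<^sup>2 \<le> - 2 * q * \<kappa>"
  shows "(a \<bullet> (A x + w) / U + b \<bullet> (A x - w) / W) / 2 + \<kappa>
    + (\<Sum>k<n. ((a \<bullet> v k / U + b \<bullet> v k / W) / 2)\<^sup>2
        + (H (x + h) (v k) \<bullet> v k / U - (a \<bullet> v k / U)\<^sup>2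
          + H (x - h) (v k) \<bullet> v k / W - (b \<bullet> v k / W)\<^sup>2) / 2) / 2 \<le> 0"
proof -
  define d where "d = a /\<^sub>R U - b /\<^sub>R W"
  define \<beta> where "\<beta> = w - A h"
  have U: "U > 0" and W: "W > 0" by (simp_all add: U_def W_def pos)
  have dv: "d \<bullet> y = a \<bullet> y / U - b \<bullet> y / W" for y
    by (simp add: d_def inner_diff_left divide_inverse mult.commute)
  have A1: "A (x + h) = A x + A h" "A (x - h) = A x - A h"
    by (simp_all add: linear_add[OF lin] linear_diff[OF lin])
  have H1: "(\<Sum>k<n. H (x + h) (v k) \<bullet> v k / U) = - 2 * (a \<bullet> (A x + A h)) / U"
    using harmonic[of "x + h"] unfolding A1 a_def[symmetric] sum_divide_distrib[symmetric]
    by (intro arg_cong[of _ _ "\<lambda>z. z / U"]) simp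
  have H2: "(\<Sum>k<n. H (x - h) (v k) \<bullet> v k / W) = - 2 * (b \<bullet> (A x - A h)) / W"
    using harmonic[of "x - h"] unfolding A1 b_def[symmetric] sum_divide_distrib[symmetric]
    by (intro arg_cong[of _ _ "\<lambda>z. z / W"]) simp
  have "(\<Sum>k<n. ((a \<bullet> v k / U + b \<bullet> v k / W) / 2)\<^sup>2
        + (H (x + h) (v k) \<bullet> v k / U - (a \<bullet> v k / U)\<^sup>2
          + H (x - h) (v k) \<bullet> v k / W - (b \<bullet> v k / W)\<^sup>2) / 2)
      = (\<Sum>k<n. (H (x + h) (v k) \<bullet> v k / U + H (x - h) (v k) \<bullet> v k / W) / 2 - (d \<bullet> v k)\<^sup>2 / 4)"
  proof (intro sum.cong refl)
    have *: "((P + R) / 2)\<^sup>2 + (p - P\<^sup>2 + r - R\<^sup>2) / 2 = (p + r) / 2 - (P - R)\<^sup>2 / 4" for P R p r :: real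
      by (simp add: power2_eq_square field_simps)
    show "((a \<bullet> v k / U + b \<bullet> v k / W) / 2)\<^sup>2
        + (H (x + h) (v k) \<bullet> v k / U - (a \<bullet> v k / U)\<^sup>2
          + H (x - h) (v k) \<bullet> v k / W - (b \<bullet> v k / W)\<^sup>2) / 2
      = (H (x + h) (v k) \<bullet> v k / U + H (x - h) (v k) \<bullet> v k / W) / 2 - (d \<bullet> v k)\<^sup>2 / 4" for k
      unfolding dv by (rule *)
  qed
  also have "\<dots> = - (a \<bullet> (A x + A h)) / U - (b \<bullet> (A x - A h)) / W - (\<Sum>k<n. (d \<bullet> v k)\<^sup>2) / 4"
  proof -
    have "\<dots> = ((\<Sum>k<n. H (x + h) (v k) \<bullet> v k / U) + (\<Sum>k<n. H (x - h) (v k) \<bullet> v k / W)) / 2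
        - (\<Sum>k<n. (d \<bullet> v k)\<^sup>2) / 4"
      by (simp add: sum_subtractf sum.distrib flip: sum_divide_distrib)
    then show ?thesis unfolding H1 H2 by (simp add: add_divide_distrib diff_divide_distrib)
  qed
  finally have E: "(a \<bullet> (A x + w) / U + b \<bullet> (A x - w) / W) / 2 + \<kappa>
    + (\<Sum>k<n. ((a \<bullet> v k / U + b \<bullet> v k / W) / 2)\<^sup>2
        + (H (x + h) (v k) \<bullet> v k / U - (a \<bullet> v k / U)\<^sup>2
          + H (x - h) (v k) \<bullet> v k / W - (b \<bullet> v k / W)\<^sup>2) / 2) / 2
    = d \<bullet> \<beta> / 2 + \<kappa> - (\<Sum>k<n. (d \<bullet> v k)\<^sup>2) / 8"
    by (simp add: dv \<beta>_def inner_add_right inner_diff_right add_divide_distrib diff_divide_distrib)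
  have "d \<bullet> \<beta> / 2 \<le> norm d * norm \<beta> / 2"
    using norm_cauchy_schwarz[of d \<beta>] by simp
  also have "\<dots> \<le> q * (norm d)\<^sup>2 / 8 + (norm \<beta>)\<^sup>2 / (2 * q)"
  proof -
    have "0 \<le> (q * norm d - 2 * norm \<beta>)\<^sup>2 / (8 * q)"
      using q_pos by simp
    also have "\<dots> = q * (norm d)\<^sup>2 / 8 + (norm \<beta>)\<^sup>2 / (2 * q) - norm d * norm \<beta> / 2"
      using q_pos by (simp add: field_simps power2_eq_square)
    finally show ?thesis by simp
  qed
  also have "\<dots> \<le> (\<Sum>k<n. (d \<bullet> v k)\<^sup>2) / 8 - \<kappa>"
  proof -
    have "(norm \<beta>)\<^sup>2 / (2 * q) \<le> - \<kappa>"
      using w q_pos by (simp add: \<beta>_def divide_le_eq mult.commute)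
    then show ?thesis using elliptic[of d] by simp
  qed
  finally show ?thesis unfolding E by simp
qed

text \<open>The left-hand side is \<open>(\<partial>\<^sub>t + L) \<Phi> / \<Phi>\<close> for \<open>\<Phi> = exp (\<theta>(t) (1 + |x|\<^sup>2))\<close> with \<open>\<theta>' = - K \<theta>\<close>. The linear drift
and the squared gradient of the exponent both contribute terms of order \<open>\<theta> |x|\<^sup>2\<close>, and only the
decay of \<open>\<theta>\<close> in time can compensate them.\<close>
lemma gaussian_barrier:
  obtains K where "K > 0" and
    "\<And>\<theta> x. 0 < \<theta> \<Longrightarrow> \<theta> \<le> 1 \<Longrightarrow>
      - K * \<theta> * (1 + x \<bullet> x) + 2 * \<theta> * (x \<bullet> A x)
        + (\<Sum>k<n. (2 * \<theta> * (x \<bullet> v k))\<^sup>2 + 2 * \<theta> * (v k \<bullet> v k)) / 2 < 0"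
proof -
  obtain M where M: "M > 0" "\<And>x. norm (A x) \<le> norm x * M"
    using lin linear_conv_bounded_linear bounded_linear.pos_bounded by blast
  define B where "B = (\<Sum>k<n. v k \<bullet> v k)"
  have B: "B \<ge> 0" by (simp add: B_def sum_nonneg)
  show thesis
  proof (rule that)
    show "2 * B + 2 * M + 1 > 0" using B M by simp
    fix \<theta> :: real and x :: 'a assume t: "0 < \<theta>" "\<theta> \<le> 1"
    have xx: "x \<bullet> x \<ge> 0" by simp
    have "(\<Sum>k<n. (2 * \<theta> * (x \<bullet> v k))\<^sup>2 + 2 * \<theta> * (v k \<bullet> v k))
        \<le> (\<Sum>k<n. (4 * \<theta> * (x \<bullet> x) + 2 * \<theta>) * (v k \<bullet> v k))"
    proof (rule sum_mono)
      fix k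
      have "\<theta>\<^sup>2 * (x \<bullet> v k)\<^sup>2 \<le> \<theta> * ((x \<bullet> x) * (v k \<bullet> v k))"
        using t Cauchy_Schwarz_ineq[of x "v k"] by (intro mult_mono) (auto simp: power2_eq_square mult_left_le)
      then show "(2 * \<theta> * (x \<bullet> v k))\<^sup>2 + 2 * \<theta> * (v k \<bullet> v k)
          \<le> (4 * \<theta> * (x \<bullet> x) + 2 * \<theta>) * (v k \<bullet> v k)"
        by (simp add: power_mult_distrib algebra_simps)
    qed
    also have "\<dots> = (4 * \<theta> * (x \<bullet> x) + 2 * \<theta>) * B"
      by (simp add: B_def sum_distrib_left)
    finally have 1: "(\<Sum>k<n. (2 * \<theta> * (x \<bullet> v k))\<^sup>2 + 2 * \<theta> * (v k \<bullet> v k)) / 2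
        \<le> \<theta> * (2 * B * (x \<bullet> x) + B)" by (simp add: algebra_simps)
    have "x \<bullet> A x \<le> norm x * norm (A x)" by (rule norm_cauchy_schwarz)
    also have "\<dots> \<le> norm x * (norm x * M)" by (intro mult_left_mono M) simp
    finally have "x \<bullet> A x \<le> M * (x \<bullet> x)"
      by (simp add: power2_norm_eq_inner[symmetric] power2_eq_square algebra_simps)
    then have 2: "2 * \<theta> * (x \<bullet> A x) \<le> \<theta> * (2 * M * (x \<bullet> x))"
      using t by simp
    have "0 < B + 2 * M + 1 + x \<bullet> x" using B M(1) xx by linarith
    then have "0 < \<theta> * (B + 2 * M + 1 + x \<bullet> x)" using t by simp
    then show "- (2 * B + 2 * M + 1) * \<theta> * (1 + x \<bullet> x) + 2 * \<theta> * (x \<bullet> A x)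
        + (\<Sum>k<n. (2 * \<theta> * (x \<bullet> v k))\<^sup>2 + 2 * \<theta> * (v k \<bullet> v k)) / 2 < 0"
      using 1 2 by (simp add: algebra_simps)
  qed
qed

text \<open>A bound on the failure of midpoint log-convexity for the displacement \<open>\<eta> T\<close> is carried back along the
path to the displacement \<open>\<eta> 0\<close>. If \<open>G - u\<close> were negative somewhere at time \<open>0\<close>, then so would be
\<open>D = G - u + \<epsilon>\<Phi>\<close> for small \<open>\<epsilon>\<close>. By the barrier, \<open>D\<close> attains its negative minimum; it does so before time
\<open>T\<close>, and there \<open>(\<partial>\<^sub>t + L) D \<ge> 0\<close>, against the strict negativity supplied by \<open>\<Phi>\<close>.\<close>
proposition log_concavity_defect_transport:
  assumes T: "0 \<le> T"
    and eta: "\<And>t. 0 \<le> t \<Longrightarrow> t \<le> T \<Longrightarrow> (\<eta> has_vector_derivative \<eta>' t) (at t)"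
    and c: "\<And>t. 0 \<le> t \<Longrightarrow> t \<le> T \<Longrightarrow> (c has_real_derivative c' t) (at t)"
    and cost: "\<And>t. 0 \<le> t \<Longrightarrow> t \<le> T \<Longrightarrow> (norm (\<eta>' t - A (\<eta> t)))\<^sup>2 \<le> - 2 * q * c' t"
    and final: "\<And>x. ln (u x) \<le> (ln (u (x + \<eta> T)) + ln (u (x - \<eta> T))) / 2 + c T"
  shows "ln (u y) \<le> (ln (u (y + \<eta> 0)) + ln (u (y - \<eta> 0))) / 2 + c 0"
proof (rule ccontr)
  assume contra: "\<not> ?thesis"
  obtain K where K: "K > 0" and barrier: "\<And>\<theta> x. 0 < \<theta> \<Longrightarrow> \<theta> \<le> 1 \<Longrightarrow>
      - K * \<theta> * (1 + x \<bullet> x) + 2 * \<theta> * (x \<bullet> A x)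
        + (\<Sum>k<n. (2 * \<theta> * (x \<bullet> v k))\<^sup>2 + 2 * \<theta> * (v k \<bullet> v k)) / 2 < 0"
    by (rule gaussian_barrier) blast
  define G where "G t x = exp ((ln (u (x + \<eta> t)) + ln (u (x - \<eta> t))) / 2 + c t)" for t x
  define \<theta> where "\<theta> t = exp (- K * t)" for t
  define \<Phi> where "\<Phi> t x = exp (\<theta> t * (1 + x \<bullet> x))" for t and x :: 'a
  have G_pos: "G t x > 0" for t x by (simp add: G_def)
  have \<Phi>_pos: "\<Phi> t x > 0" for t x by (simp add: \<Phi>_def)
  have "G 0 y < exp (ln (u y))"
    using contra by (simp add: G_def)
  then have "G 0 y < u y" by (simp add: pos)
  define \<epsilon> where "\<epsilon> = (u y - G 0 y) / (2 * \<Phi> 0 y)"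
  have \<epsilon>: "\<epsilon> > 0" using \<open>G 0 y < u y\<close> \<Phi>_pos[of 0 y] by (simp add: \<epsilon>_def)
  define D where "D t x = G t x - u x + \<epsilon> * \<Phi> t x" for t x
  have Dy: "D 0 y < 0"
    using \<open>G 0 y < u y\<close> \<Phi>_pos[of 0 y] by (simp add: D_def \<epsilon>_def field_simps)
  obtain R where R: "\<And>r. r \<ge> R \<Longrightarrow> c0 * exp (c0 * r) < \<epsilon> * exp (\<theta> T * (1 + r\<^sup>2))"
    using gaussian_dominates_exponential[OF growth(1) \<epsilon>, of "\<theta> T"] unfolding \<theta>_def by auto
  have far: "D t x > 0" if "norm x \<ge> R" "0 \<le> t" "t \<le> T" for t x
  proof -
    have "u x \<le> c0 * exp (c0 * norm x)" by (rule growth)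
    also have "\<dots> < \<epsilon> * exp (\<theta> T * (1 + (norm x)\<^sup>2))" by (rule R) fact
    also have "\<dots> \<le> \<epsilon> * \<Phi> t x"
      using \<epsilon> K that unfolding \<Phi>_def \<theta>_def
      by (simp add: power2_norm_eq_inner mult_right_mono add_nonneg_nonneg)
    finally show ?thesis using G_pos[of t x] by (simp add: D_def)
  qed
  have cont: "continuous_on ({0..T} \<times> UNIV) (\<lambda>(t, x). D t x)"
  proof -
    have ce: "continuous_on {0..T} \<eta>" and cc: "continuous_on {0..T} c"
      by (auto intro!: continuous_at_imp_continuous_on
          has_vector_derivative_continuous[OF eta] DERIV_isCont[OF c])
    have 1: "continuous_on ({0..T} \<times> (UNIV :: 'a set)) (\<lambda>z. \<eta> (fst z))"
      "continuous_on ({0..T} \<times> (UNIV :: 'a set)) (\<lambda>z. c (fst z))"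
      by (rule continuous_on_compose2[OF ce] continuous_on_compose2[OF cc];
          auto intro!: continuous_intros)+
    have 2: "continuous_on S (\<lambda>z. u (f z))" if "continuous_on S f" for S and f :: "real \<times> 'a \<Rightarrow> 'a"
      using continuous_on_compose2[OF continuous_u that] by auto
    show ?thesis
      unfolding D_def G_def \<Phi>_def \<theta>_def case_prod_unfold
      by (intro continuous_intros 1 2) (simp_all add: pos less_imp_neq[OF pos, symmetric])
  qed
  let ?R = "max R (norm y)"
  have "\<exists>z\<in>{0..T} \<times> cball 0 ?R. \<forall>z'\<in>{0..T} \<times> cball 0 ?R. (\<lambda>(t,x). D t x) z \<le> (\<lambda>(t,x). D t x) z'"
  proof (rule continuous_attains_inf)
    show "compact ({0..T} \<times> cball (0::'a) ?R)" by (intro compact_Times) auto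
    have "(0, y) \<in> {0..T} \<times> cball 0 ?R" using T by simp
    then show "{0..T} \<times> cball (0::'a) ?R \<noteq> {}" by blast
    show "continuous_on ({0..T} \<times> cball 0 ?R) (\<lambda>(t,x). D t x)"
      by (rule continuous_on_subset[OF cont]) auto
  qed
  then obtain t x where tx: "0 \<le> t" "t \<le> T"
    and min0: "\<And>t' x'. 0 \<le> t' \<Longrightarrow> t' \<le> T \<Longrightarrow> norm x' \<le> ?R \<Longrightarrow> D t x \<le> D t' x'"
    by fastforce
  have neg: "D t x < 0" using min0[of 0 y] T Dy by simp
  have min: "D t x \<le> D t' x'" if "0 \<le> t'" "t' \<le> T" for t' x'
    using min0[OF that, of x'] far[OF _ that, of x'] neg
    by (cases "norm x' \<le> ?R") (linarith, force simp: not_le)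
  have "D T x' > 0" for x'
  proof -
    have "exp (ln (u x')) \<le> G T x'"
      unfolding G_def using final[of x'] by simp
    then have "u x' \<le> G T x'"
      by (simp add: pos)
    then show ?thesis using mult_pos_pos[OF \<epsilon> \<Phi>_pos[of T x']] by (simp add: D_def)
  qed
  then have "t < T" using neg tx by (metis less_asym order_le_less)
  define E where "E = \<eta> t"
  define a where "a = g (x + E)"
  define b where "b = g (x - E)"
  have \<theta>t: "0 < \<theta> t" "\<theta> t \<le> 1" using tx K by (auto simp: \<theta>_def)
  define drift where "drift = G t x * ((a \<bullet> (A x + \<eta>' t) / u (x + E) + b \<bullet> (A x - \<eta>' t) / u (x - E)) / 2 + c' t)
    - g x \<bullet> A x + \<epsilon> * (\<Phi> t x * (- K * \<theta> t * (1 + x \<bullet> x) + 2 * \<theta> t * (x \<bullet> A x)))"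
  \<comment> \<open>the time derivative and the drift term are tested together, along the segment with velocity \<open>(1, A x)\<close>\<close>
  have "0 \<le> drift"
  proof (rule right_derivative_nonneg_at_min)
    show "T - t > 0" using \<open>t < T\<close> by simp
    show "D (t + 0) (x + 0 *\<^sub>R A x) \<le> D (t + s) (x + s *\<^sub>R A x)" if "0 \<le> s" "s \<le> T - t" for s
      using min[of "t + s"] that tx by simp
    have eta': "((\<lambda>s. \<eta> (t + s)) has_vector_derivative \<eta>' t) (at 0)"
    proof -
      have "((\<eta> \<circ> (\<lambda>s. t + s)) has_vector_derivative 1 *\<^sub>R \<eta>' t) (at 0)"
        by (rule vector_diff_chain_at) (use eta[OF tx] in \<open>auto intro!: derivative_eq_intros\<close>)
      then show ?thesis by (simp add: o_def)
    qed
    have c1: "((\<lambda>s. c (t + s)) has_real_derivative c' t) (at 0)"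
      using c[OF tx] DERIV_shift[of c "c' t" 0 t] by (simp add: add.commute)
    have u1: "((\<lambda>s. u (x + s *\<^sub>R A x + \<eta> (t + s))) has_real_derivative a \<bullet> (A x + \<eta>' t)) (at 0)"
      by (rule DERIV_cong, rule derivative_along_curve[where w = "A x + \<eta>' t"])
        (auto intro!: derivative_eq_intros eta' simp: a_def E_def)
    have u2: "((\<lambda>s. u (x + s *\<^sub>R A x - \<eta> (t + s))) has_real_derivative b \<bullet> (A x - \<eta>' t)) (at 0)"
      by (rule DERIV_cong, rule derivative_along_curve[where w = "A x - \<eta>' t"])
        (auto intro!: derivative_eq_intros eta' simp: b_def E_def)
    have G1: "((\<lambda>s. G (t + s) (x + s *\<^sub>R A x)) has_real_derivative
        G t x * ((a \<bullet> (A x + \<eta>' t) / u (x + E) + b \<bullet> (A x - \<eta>' t) / u (x - E)) / 2 + c' t)) (at 0)"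
      using geometric_mean_derivative[OF u1 u2 c1] pos by (simp add: G_def E_def)
    have P1: "((\<lambda>s. \<Phi> (t + s) (x + s *\<^sub>R A x)) has_real_derivative
        \<Phi> t x * (- K * \<theta> t * (1 + x \<bullet> x) + 2 * \<theta> t * (x \<bullet> A x))) (at 0)"
      unfolding \<Phi>_def \<theta>_def
      by (auto intro!: derivative_eq_intros simp: inner_add_left inner_add_right algebra_simps inner_commute)
    show "((\<lambda>s. D (t + s) (x + s *\<^sub>R A x)) has_real_derivative drift) (at 0)"
      unfolding D_def drift_def
      by (intro DERIV_add DERIV_diff G1 DERIV_cmult P1)
        (rule derivative_along_line[of x "A x" 0, simplified])
  qed
  moreover
  \<comment> \<open>the second derivative of \<open>D t\<close> along \<open>v k\<close> at the minimum\<close>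
  define diffusion where "diffusion k = G t x * (((a \<bullet> v k / u (x + E) + b \<bullet> v k / u (x - E)) / 2)\<^sup>2
        + (H (x + E) (v k) \<bullet> v k / u (x + E) - (a \<bullet> v k / u (x + E))\<^sup>2
          + H (x - E) (v k) \<bullet> v k / u (x - E) - (b \<bullet> v k / u (x - E))\<^sup>2) / 2)
      - H x (v k) \<bullet> v k + \<epsilon> * (\<Phi> t x * ((2 * \<theta> t * (x \<bullet> v k))\<^sup>2 + 2 * \<theta> t * (v k \<bullet> v k)))" for k
  have "0 \<le> diffusion k" for k
  proof (rule second_derivative_nonneg_at_min)
    let ?x = "\<lambda>s. x + s *\<^sub>R v k"
    let ?f = "\<lambda>s. u ((x + E) + s *\<^sub>R v k)"
    let ?h = "\<lambda>s. u ((x - E) + s *\<^sub>R v k)"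
    let ?f1 = "\<lambda>s. g ((x + E) + s *\<^sub>R v k) \<bullet> v k"
    let ?h1 = "\<lambda>s. g ((x - E) + s *\<^sub>R v k) \<bullet> v k"
    let ?G = "\<lambda>s. exp ((ln (?f s) + ln (?h s)) / 2 + c t)"
    have G_eq: "G t (?x s) = ?G s" for s
      by (simp add: G_def E_def algebra_simps)
    show "D t (x + 0 *\<^sub>R v k) \<le> D t (?x s)" for s
      using min tx by simp
    show "((\<lambda>s. D t (?x s)) has_real_derivative
        ?G s * ((?f1 s / ?f s + ?h1 s / ?h s) / 2) - g (?x s) \<bullet> v k
          + \<epsilon> * (\<Phi> t (?x s) * (2 * \<theta> t * (?x s \<bullet> v k)))) (at s)" for s
    proof -
      have 1: "((\<lambda>s. G t (?x s)) has_real_derivative ?G s * ((?f1 s / ?f s + ?h1 s / ?h s) / 2)) (at s)"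
        unfolding G_eq
        using geometric_mean_derivative[OF derivative_along_line derivative_along_line DERIV_const[of "c t"]] pos
        by fastforce
      have 2: "((\<lambda>s. \<Phi> t (?x s)) has_real_derivative \<Phi> t (?x s) * (2 * \<theta> t * (?x s \<bullet> v k))) (at s)"
        unfolding \<Phi>_def
        by (auto intro!: derivative_eq_intros simp: inner_add_left inner_add_right algebra_simps inner_commute)
      show ?thesis
        unfolding D_def by (intro DERIV_add DERIV_diff DERIV_cmult 1 2 derivative_along_line)
    qed
    show "((\<lambda>s. ?G s * ((?f1 s / ?f s + ?h1 s / ?h s) / 2) - g (?x s) \<bullet> v k
          + \<epsilon> * (\<Phi> t (?x s) * (2 * \<theta> t * (?x s \<bullet> v k)))) has_real_derivative diffusion k) (at 0)"
    proof -
      have 1: "((\<lambda>s. ?G s * ((?f1 s / ?f s + ?h1 s / ?h s) / 2)) has_real_derivative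
         G t x * (((a \<bullet> v k / u (x + E) + b \<bullet> v k / u (x - E)) / 2)\<^sup>2
        + (H (x + E) (v k) \<bullet> v k / u (x + E) - (a \<bullet> v k / u (x + E))\<^sup>2
          + H (x - E) (v k) \<bullet> v k / u (x - E) - (b \<bullet> v k / u (x - E))\<^sup>2) / 2)) (at 0)"
        using geometric_mean_second_derivative[where f = ?f and k = ?h and ?f1.0 = ?f1 and ?k1.0 = ?h1
            and s = 0 and C = "c t", OF derivative_along_line derivative_along_line
            second_derivative_along_line second_derivative_along_line] pos
        by (simp add: G_def E_def a_def b_def)
      have 2: "((\<lambda>s. \<Phi> t (?x s) * (2 * \<theta> t * (?x s \<bullet> v k))) has_real_derivative
          \<Phi> t x * ((2 * \<theta> t * (x \<bullet> v k))\<^sup>2 + 2 * \<theta> t * (v k \<bullet> v k))) (at 0)"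
        unfolding \<Phi>_def
        by (auto intro!: derivative_eq_intros
            simp: inner_add_left inner_add_right algebra_simps inner_commute power2_eq_square)
      show ?thesis
        unfolding diffusion_def
        by (intro DERIV_add DERIV_diff DERIV_cmult 1 2 second_derivative_along_line)
    qed
  qed
  then have "0 \<le> (\<Sum>k<n. diffusion k) / 2" by (simp add: sum_nonneg)
  ultimately have "0 \<le> drift + (\<Sum>k<n. diffusion k) / 2" by simp
  also have "\<dots> = G t x * ((a \<bullet> (A x + \<eta>' t) / u (x + E) + b \<bullet> (A x - \<eta>' t) / u (x - E)) / 2 + c' t
      + (\<Sum>k<n. ((a \<bullet> v k / u (x + E) + b \<bullet> v k / u (x - E)) / 2)\<^sup>2
        + (H (x + E) (v k) \<bullet> v k / u (x + E) - (a \<bullet> v k / u (x + E))\<^sup>2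
          + H (x - E) (v k) \<bullet> v k / u (x - E) - (b \<bullet> v k / u (x - E))\<^sup>2) / 2) / 2)
    - ((\<Sum>k<n. H x (v k) \<bullet> v k) / 2 + g x \<bullet> A x)
    + \<epsilon> * \<Phi> t x * (- K * \<theta> t * (1 + x \<bullet> x) + 2 * \<theta> t * (x \<bullet> A x)
        + (\<Sum>k<n. (2 * \<theta> t * (x \<bullet> v k))\<^sup>2 + 2 * \<theta> t * (v k \<bullet> v k)) / 2)"
  proof -
    have 1: "(\<Sum>k<n. G * X k - Y k + e * (p * Z k)) = G * (\<Sum>k<n. X k) - (\<Sum>k<n. Y k) + e * (p * (\<Sum>k<n. Z k))"
      for G e p :: real and X Y Z
      by (simp add: sum.distrib sum_subtractf sum_distrib_left)
    have 2: "(G * a - y + e * (p * b)) + (G * S - Y + e * (p * Z)) / 2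
        = G * (a + S / 2) - (Y / 2 + y) + e * p * (b + Z / 2)" for G a y e p b S Y Z :: real
      by (simp add: field_simps)
    show ?thesis unfolding drift_def diffusion_def 1 by (rule 2)
  qed
  also have "\<dots> < 0"
  proof -
    have "G t x * ((a \<bullet> (A x + \<eta>' t) / u (x + E) + b \<bullet> (A x - \<eta>' t) / u (x - E)) / 2 + c' t
      + (\<Sum>k<n. ((a \<bullet> v k / u (x + E) + b \<bullet> v k / u (x - E)) / 2)\<^sup>2
        + (H (x + E) (v k) \<bullet> v k / u (x + E) - (a \<bullet> v k / u (x + E))\<^sup>2
          + H (x - E) (v k) \<bullet> v k / u (x - E) - (b \<bullet> v k / u (x - E))\<^sup>2) / 2) / 2) \<le> 0"
      unfolding a_def b_def
      by (rule mult_nonneg_nonpos[OF less_imp_le[OF G_pos] generator_of_geometric_mean_nonpos])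
        (use cost[OF tx] in \<open>simp add: E_def\<close>)
    moreover have "\<epsilon> * \<Phi> t x * (- K * \<theta> t * (1 + x \<bullet> x) + 2 * \<theta> t * (x \<bullet> A x)
        + (\<Sum>k<n. (2 * \<theta> t * (x \<bullet> v k))\<^sup>2 + 2 * \<theta> t * (v k \<bullet> v k)) / 2) < 0"
      by (rule mult_pos_neg[OF mult_pos_pos[OF \<epsilon> \<Phi>_pos] barrier[OF \<theta>t]])
    ultimately show ?thesis using harmonic[of x] by linarith
  qed
  finally show False by simp
qed

end

context positive_ou_solution
begin

text \<open>The crude bound from the straight path \<open>(1 - t) h\<close>. It is used only for the short displacement left
when a cheap path, which reaches the origin in infinite time, is cut off.\<close>
lemma linear_path_defect:
  obtains C where "\<And>h x. ln (u x) \<le> (ln (u (x + h)) + ln (u (x - h))) / 2 + C * (norm h)\<^sup>2"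
proof -
  obtain M where M: "M > 0" "\<And>x. norm (A x) \<le> norm x * M"
    using lin linear_conv_bounded_linear bounded_linear.pos_bounded by blast
  have "ln (u x) \<le> (ln (u (x + h)) + ln (u (x - h))) / 2 + (1 + M)\<^sup>2 / (2 * q) * (norm h)\<^sup>2" for h x
  proof -
    define E where "E = (1 + M)\<^sup>2 / (2 * q) * (norm h)\<^sup>2"
    let ?\<eta> = "\<lambda>t. (1 - t) *\<^sub>R h"
    have "ln (u x) \<le> (ln (u (x + ?\<eta> 0)) + ln (u (x - ?\<eta> 0))) / 2 + (1 - 0) * E"
    proof (rule log_concavity_defect_transport[where T = 1 and \<eta>' = "\<lambda>_. - h" and c' = "\<lambda>_. - E" and c = "\<lambda>t. (1 - t) * E" and \<eta> = ?\<eta>])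
      fix t :: real assume t: "0 \<le> t" "t \<le> 1"
      show "(?\<eta> has_vector_derivative - h) (at t)"
        by (auto intro!: derivative_eq_intros)
      show "((\<lambda>t. (1 - t) * E) has_real_derivative - E) (at t)"
        by (auto intro!: derivative_eq_intros)
      have "norm (- h - A (?\<eta> t)) \<le> norm h + norm (A (?\<eta> t))"
        using norm_triangle_ineq4[of "- h" "A (?\<eta> t)"] by simp
      also have "\<dots> \<le> norm h + norm (?\<eta> t) * M"
        using M(2)[of "?\<eta> t"] by simp
      also have "\<dots> \<le> norm h + norm h * M"
        using t M(1) by (intro add_left_mono mult_right_mono) (simp_all add: mult_left_le_one_le)
      finally have "(norm (- h - A (?\<eta> t)))\<^sup>2 \<le> ((1 + M) * norm h)\<^sup>2"
        by (intro power_mono) (simp_all add: algebra_simps)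
      then show "(norm (- h - A (?\<eta> t)))\<^sup>2 \<le> - 2 * q * - E"
        using q_pos by (simp add: E_def power_mult_distrib)
    qed auto
    then show ?thesis by (simp add: E_def)
  qed
  then show thesis by (rule that)
qed

text \<open>A cheap path is followed up to time \<open>T\<close> and the remaining displacement \<open>\<eta> T\<close> is steered along a
straight line; the cost of the latter vanishes as \<open>T\<close> tends to infinity.\<close>
proposition midpoint_log_convex:
  assumes "cheaply_steerable A h"
  shows "2 * ln (u x) \<le> ln (u (x + h)) + ln (u (x - h))"
proof -
  obtain C where C: "\<And>h x. ln (u x) \<le> (ln (u (x + h)) + ln (u (x - h))) / 2 + C * (norm h)\<^sup>2"
    using linear_path_defect by blast
  have "ln (u x) \<le> (ln (u (x + h)) + ln (u (x - h))) / 2 + e" if "e > 0" for e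
  proof -
    have "2 * q * e > 0" using that q_pos by simp
    then obtain \<eta> \<eta>' c c' where
      1: "\<And>t. t \<ge> 0 \<Longrightarrow> (\<eta> has_vector_derivative \<eta>' t) (at t)" "\<eta> 0 = h" "(\<eta> \<longlongrightarrow> 0) at_top"
      "\<And>t. t \<ge> 0 \<Longrightarrow> (c has_real_derivative c' t) (at t)" "\<And>t. t \<ge> 0 \<Longrightarrow> 0 \<le> c t" "c 0 \<le> 2 * q * e"
      "\<And>t. t \<ge> 0 \<Longrightarrow> (norm (\<eta>' t - A (\<eta> t)))\<^sup>2 \<le> - c' t"
      using assms[unfolded cheaply_steerable_def, rule_format, of "2 * q * e"] by auto
    have bound: "ln (u x) \<le> (ln (u (x + h)) + ln (u (x - h))) / 2 + (e + C * (norm (\<eta> T))\<^sup>2)" if "T \<ge> 0" for T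
    proof -
      let ?c = "\<lambda>t. c t / (2 * q) + C * (norm (\<eta> T))\<^sup>2"
      have "ln (u x) \<le> (ln (u (x + \<eta> 0)) + ln (u (x - \<eta> 0))) / 2 + ?c 0"
      proof (rule log_concavity_defect_transport[where \<eta> = \<eta> and \<eta>' = \<eta>'
            and c = ?c and c' = "\<lambda>t. c' t / (2 * q)", OF that])
        fix t assume t: "0 \<le> t" "t \<le> T"
        show "(\<eta> has_vector_derivative \<eta>' t) (at t)" by (rule 1(1)) fact
        show "(?c has_real_derivative c' t / (2 * q)) (at t)"
          using DERIV_add[OF DERIV_cdivide[OF 1(4)[OF t(1)], of "2 * q"] DERIV_const] by simp
        show "(norm (\<eta>' t - A (\<eta> t)))\<^sup>2 \<le> - 2 * q * (c' t / (2 * q))"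
          using 1(7)[OF t(1)] q_pos by simp
      next
        fix x
        have "c T / (2 * q) \<ge> 0" using 1(5)[OF that] q_pos by simp
        then show "ln (u x) \<le> (ln (u (x + \<eta> T)) + ln (u (x - \<eta> T))) / 2 + ?c T"
          using C[of x "\<eta> T"] by simp
      qed
      moreover have "c 0 / (2 * q) \<le> e" using 1(6) q_pos by (simp add: field_simps)
      ultimately show ?thesis by (simp add: 1(2))
    qed
    have "((\<lambda>T. (ln (u (x + h)) + ln (u (x - h))) / 2 + (e + C * (norm (\<eta> T))\<^sup>2)) \<longlongrightarrow>
        (ln (u (x + h)) + ln (u (x - h))) / 2 + (e + C * (norm (0 :: 'a))\<^sup>2)) at_top"
      by (intro tendsto_intros 1(3))
    then have "ln (u x) \<le> (ln (u (x + h)) + ln (u (x - h))) / 2 + (e + C * (norm (0 :: 'a))\<^sup>2)"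
    proof (rule tendsto_lowerbound)
      show "\<forall>\<^sub>F T in at_top. ln (u x) \<le> (ln (u (x + h)) + ln (u (x - h))) / 2 + (e + C * (norm (\<eta> T))\<^sup>2)"
        using eventually_ge_at_top[of 0] by (rule eventually_mono) (rule bound)
    qed simp
    then show ?thesis by simp
  qed
  then have "ln (u x) \<le> (ln (u (x + h)) + ln (u (x - h))) / 2"
    by (rule field_le_epsilon)
  then show ?thesis by simp
qed

text \<open>By log-convexity \<open>ln u(s v) + ln u(- s v)\<close> is minimal at \<open>s = 0\<close>, so its second derivative is
non-negative there: \<open>(Du(0) \<bullet> v)\<^sup>2 \<le> u(0) D\<^sup>2u(0)(v, v)\<close>. Summed over the \<open>v k\<close> the right-hand side is
\<open>2 u(0) Lu(0) = 0\<close>, since the drift vanishes at the origin.\<close>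
lemma gradient_0_eq_0:
  assumes lc: "\<And>h. 2 * ln (u 0) \<le> ln (u h) + ln (u (- h))"
  shows "g 0 = 0"
proof -
  have k: "(g 0 \<bullet> v k)\<^sup>2 \<le> u 0 * (H 0 (v k) \<bullet> v k)" for k
  proof -
    let ?f = "\<lambda>s. u (s *\<^sub>R v k)" and ?h = "\<lambda>s. u (s *\<^sub>R - v k)"
    let ?f1 = "\<lambda>s. g (s *\<^sub>R v k) \<bullet> v k" and ?h1 = "\<lambda>s. g (s *\<^sub>R - v k) \<bullet> - v k"
    have f: "(?f has_real_derivative ?f1 s) (at s)" and h: "(?h has_real_derivative ?h1 s) (at s)" for s
      using derivative_along_line[of 0 "v k" s] derivative_along_line[of 0 "- v k" s]
      by (simp_all only: add_0)
    have f1: "(?f1 has_real_derivative H 0 (v k) \<bullet> v k) (at 0)"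
      using second_derivative_along_line[of 0 "v k"] by simp
    have h1: "(?h1 has_real_derivative H 0 (v k) \<bullet> v k) (at 0)"
      using second_derivative_along_line[of 0 "- v k"] linear_neg[OF has_derivative_linear[OF hessian]] by simp
    have "0 \<le> 2 * ((H 0 (v k) \<bullet> v k) / u 0 - (g 0 \<bullet> v k / u 0)\<^sup>2)"
    proof (rule second_derivative_nonneg_at_min)
      show "((\<lambda>s. ln (?f s) + ln (?h s)) has_real_derivative ?f1 s / ?f s + ?h1 s / ?h s) (at s)" for s
      proof -
        have L: "((\<lambda>s. ln (F s)) has_real_derivative F' / F s) (at s)"
          if "(F has_real_derivative F') (at s)" "F s > 0" for F F'
          using that by (auto intro!: derivative_eq_intros)
        show ?thesis by (rule DERIV_add[OF L[OF f pos] L[OF h pos]])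
      qed
      have "((\<lambda>s. ?f1 s / ?f s + ?h1 s / ?h s) has_real_derivative
          ((H 0 (v k) \<bullet> v k) * ?f 0 - ?f1 0 * ?f1 0) / (?f 0 * ?f 0)
          + ((H 0 (v k) \<bullet> v k) * ?h 0 - ?h1 0 * ?h1 0) / (?h 0 * ?h 0)) (at 0)"
        by (intro DERIV_add DERIV_divide f h f1 h1) (simp_all add: pos less_imp_neq[OF pos, symmetric])
      then show "((\<lambda>s. ?f1 s / ?f s + ?h1 s / ?h s) has_real_derivative
          2 * ((H 0 (v k) \<bullet> v k) / u 0 - (g 0 \<bullet> v k / u 0)\<^sup>2)) (at 0)"
        by (rule DERIV_cong) (use pos[of 0] in \<open>simp add: field_simps power2_eq_square\<close>)
      show "ln (?f 0) + ln (?h 0) \<le> ln (?f s) + ln (?h s)" for s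
        using lc[of "s *\<^sub>R v k"] by simp
    qed
    then show ?thesis
      using pos[of 0] by (simp add: field_simps power2_eq_square)
  qed
  have "q * (norm (g 0))\<^sup>2 \<le> (\<Sum>k<n. (g 0 \<bullet> v k)\<^sup>2)" by (rule elliptic)
  also have "\<dots> \<le> (\<Sum>k<n. u 0 * (H 0 (v k) \<bullet> v k))" by (intro sum_mono k)
  also have "\<dots> = 0"
    using harmonic[of 0] by (simp add: linear_0[OF lin] flip: sum_distrib_left)
  finally show ?thesis
    using q_pos by (simp add: mult_le_0_iff)
qed

text \<open>Along a line through the origin the difference quotients of \<open>ln u\<close> with base point \<open>0\<close> do not increase
when the step is halved, and they tend to the derivative at \<open>0\<close>, which is \<open>0\<close>.\<close>
lemma origin_is_minimum:
  assumes lc: "\<And>x h. 2 * ln (u x) \<le> ln (u (x + h)) + ln (u (x - h))"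
  shows "u 0 \<le> u h"
proof -
  define \<psi> where "\<psi> s = ln (u (s *\<^sub>R h))" for s
  have "g 0 = 0"
    by (rule gradient_0_eq_0) (use lc[of 0] in simp)
  then have "((\<lambda>s. u (s *\<^sub>R h)) has_real_derivative 0) (at 0)"
    using derivative_along_line[of 0 h 0] by simp
  then have "(\<psi> has_real_derivative 0) (at 0)"
    unfolding \<psi>_def by (auto intro!: derivative_eq_intros simp: pos)
  then have "((\<lambda>s. (\<psi> s - \<psi> 0) / s) \<longlongrightarrow> 0) (at 0)"
    by (simp add: has_field_derivative_iff)
  moreover have "filterlim (\<lambda>n. (1/2) ^ n :: real) (at 0) sequentially"
    by (intro filterlim_atI LIMSEQ_realpow_zero) auto
  ultimately have lim: "(\<lambda>n. (\<psi> ((1/2) ^ n) - \<psi> 0) / (1/2) ^ n) \<longlonglongrightarrow> 0"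
    by (rule filterlim_compose)
  have half: "2 * \<psi> (s / 2) \<le> \<psi> s + \<psi> 0" for s
  proof -
    have "(s / 2) *\<^sub>R h + (s / 2) *\<^sub>R h = s *\<^sub>R h"
      unfolding scaleR_left_distrib[symmetric] by simp
    then show ?thesis using lc[of "(s / 2) *\<^sub>R h" "(s / 2) *\<^sub>R h"] by (simp add: \<psi>_def)
  qed
  have "(\<psi> ((1/2) ^ n) - \<psi> 0) / (1/2) ^ n \<le> \<psi> 1 - \<psi> 0" for n
  proof (induction n)
    case (Suc n)
    have "(\<psi> ((1/2) ^ Suc n) - \<psi> 0) / (1/2) ^ Suc n = (2 * \<psi> ((1/2) ^ n / 2) - 2 * \<psi> 0) / (1/2) ^ n"
      by simp
    also have "\<dots> \<le> (\<psi> ((1/2) ^ n) - \<psi> 0) / (1/2) ^ n"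
      using half[of "(1/2) ^ n"] by (intro divide_right_mono) auto
    finally show ?case using Suc by simp
  qed simp
  then have "0 \<le> \<psi> 1 - \<psi> 0"
    by (intro LIMSEQ_le_const2[OF lim]) auto
  then show ?thesis by (simp add: \<psi>_def pos)
qed

end

section \<open>The Liouville theorem\<close>

lemma pos_def_matrix_coercive:
  assumes "pos_def_matrix Q"
  obtains q where "q > 0" "\<And>d. q * (norm d)\<^sup>2 \<le> d \<bullet> (Q *v d)"
proof -
  have "continuous_on (sphere 0 1) (\<lambda>d. d \<bullet> (Q *v d))"
    by (intro continuous_on_inner continuous_on_id linear_continuous_on matrix_vector_mul_bounded_linear)
  moreover have "sphere 0 1 \<noteq> ({} :: (real^'a) set)"
    by simp
  ultimately obtain e where e: "norm e = 1" "\<And>d. norm d = 1 \<Longrightarrow> e \<bullet> (Q *v e) \<le> d \<bullet> (Q *v d)"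
    using continuous_attains_inf[of "sphere 0 1" "\<lambda>d. d \<bullet> (Q *v d)"] by (auto simp: compact_sphere)
  show thesis
  proof
    have "e \<noteq> 0" using e(1) by auto
    then show "e \<bullet> (Q *v e) > 0"
      using assms unfolding pos_def_matrix_def by blast
    show "e \<bullet> (Q *v e) * (norm d)\<^sup>2 \<le> d \<bullet> (Q *v d)" for d
    proof (cases "d = 0")
      case False
      define w where "w = d /\<^sub>R norm d"
      have "norm w = 1" and d: "d = norm d *\<^sub>R w"
        using False by (auto simp: w_def)
      have "d \<bullet> (Q *v d) = (norm d)\<^sup>2 * (w \<bullet> (Q *v w))"
        by (subst (1 2) d) (simp add: matrix_vector_mult_scaleR power2_eq_square)
      then show ?thesis
        using e(2)[OF \<open>norm w = 1\<close>] by (simp add: mult.commute mult_right_mono)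
    qed simp
  qed
qed

lemma trace_sum_of_squares:
  fixes Q B :: "real^'n^'n"
  assumes Q: "\<And>x. Q *v x = (\<Sum>k<m. (v k \<bullet> x) *\<^sub>R v k)"
  shows "trace (Q ** B) = (\<Sum>k<m. (B *v v k) \<bullet> v k)"
proof -
  have Qij: "Q $ i $ j = (\<Sum>k<m. v k $ j * v k $ i)" for i j
  proof -
    have "Q $ i $ j = (Q *v axis j 1) $ i"
      by (simp add: matrix_vector_mult_basis column_def)
    then show ?thesis
      by (simp add: Q inner_axis)
  qed
  have "trace (Q ** B) = (\<Sum>i\<in>UNIV. \<Sum>j\<in>UNIV. \<Sum>k<m. v k $ j * v k $ i * B $ j $ i)"
    by (simp add: trace_def matrix_matrix_mult_def Qij sum_distrib_right)
  also have "\<dots> = (\<Sum>i\<in>UNIV. \<Sum>k<m. \<Sum>j\<in>UNIV. v k $ j * v k $ i * B $ j $ i)"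
    by (rule sum.cong[OF refl sum.swap])
  also have "\<dots> = (\<Sum>k<m. \<Sum>i\<in>UNIV. \<Sum>j\<in>UNIV. v k $ j * v k $ i * B $ j $ i)"
    by (rule sum.swap)
  also have "\<dots> = (\<Sum>k<m. \<Sum>j\<in>UNIV. \<Sum>i\<in>UNIV. v k $ j * v k $ i * B $ j $ i)"
    by (rule sum.cong[OF refl sum.swap])
  also have "\<dots> = (\<Sum>k<m. (B *v v k) \<bullet> v k)"
    unfolding inner_vec_def matrix_vector_mult_def vec_lambda_beta inner_real_def sum_distrib_right
    by (intro sum.cong refl) (simp add: mult_ac)
  finally show ?thesis .
qed

theorem theorem4p1:
  fixes Q A :: "real^'n^'n" and u :: "real^'n \<Rightarrow> real"
  assumes "pos_def_matrix Q"
    and "spectral_bound A \<le> 0"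
    and "C2 u"
    and "\<And>x. u x \<ge> 0"
    and "\<And>x. ornstein_uhlenbeck Q A u x = 0"
    and "\<exists>c0>0. \<forall>x. \<bar>u x\<bar> \<le> c0 * exp (c0 * norm x)"
  shows "u constant_on UNIV"
proof -
  have sym: "x \<bullet> (Q *v y) = (Q *v x) \<bullet> y" for x y
    using assms(1) dot_lmul_matrix[of x Q y] transpose_matrix_vector[of Q x]
    unfolding pos_def_matrix_def by simp
  have psd: "0 \<le> x \<bullet> (Q *v x)" for x
    using assms(1) unfolding pos_def_matrix_def by (cases "x = 0") (auto intro: less_imp_le)
  obtain m :: nat and v where v: "\<forall>x. Q *v x = (\<Sum>k<m. (v k \<bullet> x) *\<^sub>R v k)"
    using psd_sum_of_squares[OF matrix_vector_mul_linear[of Q] sym psd] by (elim exE)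
  obtain q where q: "q > 0" "\<And>d. q * (norm d)\<^sup>2 \<le> d \<bullet> (Q *v d)"
    using pos_def_matrix_coercive[OF assms(1)] by blast
  obtain c0 where c0: "c0 > 0" "\<And>x. \<bar>u x\<bar> \<le> c0 * exp (c0 * norm x)"
    using assms(6) by blast
  \<comment> \<open>adding constants gives strictly positive solutions, to which logarithms apply\<close>
  have shifted: "positive_ou_solution v m ((*v) A) (\<lambda>x. u x + \<kappa>) (gradient u) (\<lambda>x h. hessian u x *v h) q (c0 + \<bar>\<kappa>\<bar>)"
    if "\<And>x. u x + \<kappa> > 0" for \<kappa>
  proof -
    have lin: "linear ((*v) A)" by (rule matrix_vector_mul_linear)
    have elliptic: "q * (norm d)\<^sup>2 \<le> (\<Sum>k<m. (d \<bullet> v k)\<^sup>2)" for d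
      using q(2)[of d] by (simp add: v inner_sum_right power2_eq_square inner_commute)
    have diff: "u differentiable (at x)" "gradient u differentiable (at x)" for x
      using assms(3) by (auto simp: C2_def differentiable_on_def)
    have grad: "((\<lambda>x. u x + \<kappa>) has_derivative (\<lambda>h. gradient u x \<bullet> h)) (at x)" for x
      using has_derivative_add_const[of u _ "at x" \<kappa>] GDERIV_gradient[OF diff(1)]
      by (simp add: gderiv_def inner_commute)
    have hess: "(gradient u has_derivative (\<lambda>h. hessian u x *v h)) (at x)" for x
      using diff(2)[of x] unfolding hessian_def jacobian_works .
    have harmonic: "(\<Sum>k<m. (hessian u x *v v k) \<bullet> v k) / 2 + gradient u x \<bullet> (A *v x) = 0" for x
      using assms(5)[of x] trace_sum_of_squares[where Q = Q and m = m and v = v and B = "hessian u x"] v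
      by (simp add: ornstein_uhlenbeck_def inner_commute)
    have growth: "u x + \<kappa> \<le> (c0 + \<bar>\<kappa>\<bar>) * exp ((c0 + \<bar>\<kappa>\<bar>) * norm x)" for x
    proof -
      have "u x + \<kappa> \<le> c0 * exp (c0 * norm x) + \<bar>\<kappa>\<bar> * 1"
        using c0(2)[of x] by linarith
      also have "\<dots> \<le> c0 * exp ((c0 + \<bar>\<kappa>\<bar>) * norm x) + \<bar>\<kappa>\<bar> * exp ((c0 + \<bar>\<kappa>\<bar>) * norm x)"
        using c0(1) by (intro add_mono mult_left_mono) (auto intro!: mult_right_mono)
      finally show ?thesis by (simp add: algebra_simps)
    qed
    have "c0 + \<bar>\<kappa>\<bar> > 0" using c0(1) by simp
    show ?thesis
      by (rule positive_ou_solution.intro) (fact lin q(1) elliptic grad hess harmonic growth that \<open>c0 + \<bar>\<kappa>\<bar> > 0\<close>)+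
  qed
  have lc: "2 * ln (u x + \<kappa>) \<le> ln (u (x + h) + \<kappa>) + ln (u (x - h) + \<kappa>)"
    if "\<And>x. u x + \<kappa> > 0" for x h \<kappa>
    by (rule positive_ou_solution.midpoint_log_convex[OF shifted[OF that] cheaply_steerable_real[OF assms(2)]])
  have min: "u 0 \<le> u h" for h
  proof -
    have p: "u x + 1 > 0" for x using assms(4)[of x] by simp
    have "u 0 + 1 \<le> u h + 1"
      by (rule positive_ou_solution.origin_is_minimum[OF shifted[OF p]]) (rule lc[OF p])
    then show ?thesis by simp
  qed
  have "u h = u 0" for h
  proof -
    define w where "w x = u x - u 0" for x
    have w: "w x \<ge> 0" for x using min by (simp add: w_def)
    \<comment> \<open>log-convexity of \<open>w + \<epsilon>\<close>, centred at \<open>h\<close> and with displacement \<open>h\<close>\<close>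
    have "(w h + \<epsilon>)\<^sup>2 \<le> (w (h + h) + \<epsilon>) * \<epsilon>" if "\<epsilon> > 0" for \<epsilon>
    proof -
      have p: "w x + \<epsilon> > 0" for x using w[of x] that by simp
      have "2 * ln (w h + \<epsilon>) \<le> ln (w (h + h) + \<epsilon>) + ln \<epsilon>"
        using lc[of "\<epsilon> - u 0" h h] p by (simp add: w_def algebra_simps)
      then have "ln ((w h + \<epsilon>)\<^sup>2) \<le> ln ((w (h + h) + \<epsilon>) * \<epsilon>)"
        by (simp only: ln_mult_pos[OF p that] ln_realpow)
      then show ?thesis
        by (rule ln_le_cancel_iff[THEN iffD1, OF zero_less_power[OF p] mult_pos_pos[OF p that]])
    qed
    then have ev: "\<forall>\<^sub>F \<epsilon> in at_right 0. (w h + \<epsilon>)\<^sup>2 \<le> (w (h + h) + \<epsilon>) * \<epsilon>"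
      using eventually_at_right_less[of "0::real"] by (auto elim: eventually_mono)
    have lim: "((\<lambda>\<epsilon>. (w h + \<epsilon>)\<^sup>2) \<longlongrightarrow> (w h + 0)\<^sup>2) (at_right 0)"
      "((\<lambda>\<epsilon>. (w (h + h) + \<epsilon>) * \<epsilon>) \<longlongrightarrow> (w (h + h) + 0) * 0) (at_right 0)"
      by (intro tendsto_intros)+
    have "(w h + 0)\<^sup>2 \<le> (w (h + h) + 0) * 0"
      by (rule tendsto_le[OF trivial_limit_at_right_real lim(2,1) ev])
    then show ?thesis by (simp add: w_def)
  qed
  then show ?thesis
    unfolding constant_on_def by blast
qed

end
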